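(* Let $X$ be a hyperbolic Riemann surface, let $\Omega\subset X$ be a Bloch domain of $X$, and let $\{f_\nu\}_{\nu\in\mathbb{N}}$ be a sequence of holomorphic self-maps of $X$ such that $f_\nu(X)\subseteq\Omega$ for all $\nu\in\mathbb{N}$. Let $\{L_\nu\}$ be the left iterated function system generated by $\{f_\nu\}$, that is, $L_\nu=f_\nu\circ f_{\nu-1}\circ\cdots\circ f_0$. Then: (i) all limit points of $\{L_\nu\}$ in $\mathrm{Hol}(X,X)$ are constant maps; (ii) let $z_\nu\in\Omega$ be the unique fixed point of $f_\nu$. Then, for $z_\infty\in X$, the sequence $\{L_\nu\}$ converges to the constant map $z_\infty$ if and only if $z_\nu\to z_\infty$ as $\nu\to+\infty$.
   Context: A Riemann surface is hyperbolic if its universal covering is the unit disk $\mathbb{D}=\{z\in\mathbb{C}: |z|<1\}$. For a hyperbolic Riemann surface $X$, $\omega_X$ denotes the Poincaré distance of $X$ (the complete distance on $X$ induced by the Poincaré metric of $\mathbb{D}$ via the universal covering map), and $B_X(z,r)$ denotes the open $\omega_X$-ball of center $z\in X$ and radius $r>0$. For a domain (nonempty connected open subset) $\Omega\subset X$ put $R(\Omega,X)=\sup\{r>0 \mid \exists z\in\Omega: B_X(z,r)\subseteq\Omega\}$; $\Omega$ is a Bloch domain of $X$ if $R(\Omega,X)<+\infty$. $\mathrm{Hol}(X,Y)$ denotes the space of holomorphic maps from $X$ to $Y$ with the compact-open topology (equivalently, uniform convergence on compact subsets); limit points (limits of subsequences) and convergence of sequences of maps are with respect to this topology. Every holomorphic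 self-map $f$ of $X$ with $f(X)\subseteq\Omega$, $\Omega$ a Bloch domain of $X$, has exactly one fixed point in $X$, and it lies in $\Omega$. By convention, the maps generating an iterated function system are all different from the identity $\mathrm{id}_X$. *)

theory Defs
  imports "HOL-Complex_Analysis.Complex_Analysis"
begin

section \<open>Riemann surfaces and holomorphic maps\<close>

text \<open>A surface is a set \<open>X\<close> with its subspace topology together with an atlas; a chart is a pair
  \<open>(U, \<phi>)\<close> of which only the restriction of \<open>\<phi>\<close> to \<open>U\<close> matters. The atlas need not be maximal.\<close>

type_synonym 'a chart = "'a set \<times> ('a \<Rightarrow> complex)"

definition riemann_surface :: "'a::topological_space set \<Rightarrow> 'a chart set \<Rightarrow> bool" where
  "riemann_surface X \<A> \<longleftrightarrow>
     X \<noteq> {} \<and> connected X \<and> Hausdorff_space (top_of_set X) \<and>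
     (\<Union>(U, \<phi>)\<in>\<A>. U) = X \<and>
     (\<forall>(U, \<phi>)\<in>\<A>. openin (top_of_set X) U \<and> open (\<phi> ` U) \<and>
                  homeomorphism U (\<phi> ` U) \<phi> (inv_into U \<phi>)) \<and>
     (\<forall>(U, \<phi>)\<in>\<A>. \<forall>(V, \<psi>)\<in>\<A>. (\<psi> \<circ> inv_into U \<phi>) holomorphic_on \<phi> ` (U \<inter> V))"

text \<open>Maps are total functions of which only the values on \<open>X\<close> matter, so \<open>Hol X \<A> Y \<B>\<close> does not
  identify functions that agree on \<open>X\<close>; the topology on it below does not separate them either.\<close>

definition Hol :: "'a::topological_space set \<Rightarrow> 'a chart set \<Rightarrow>
    'b::topological_space set \<Rightarrow> 'b chart set \<Rightarrow> ('a \<Rightarrow> 'b) set" where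
  "Hol X \<A> Y \<B> = {f. continuous_on X f \<and> f ` X \<subseteq> Y \<and>
     (\<forall>(U, \<phi>)\<in>\<A>. \<forall>(V, \<psi>)\<in>\<B>.
        (\<psi> \<circ> f \<circ> inv_into U \<phi>) holomorphic_on \<phi> ` (U \<inter> f -` V))}"

definition Hol_topology :: "'a::topological_space set \<Rightarrow> 'a chart set \<Rightarrow>
    'b::topological_space set \<Rightarrow> 'b chart set \<Rightarrow> ('a \<Rightarrow> 'b) topology" where
  "Hol_topology X \<A> Y \<B> = topology_generated_by
     {{f \<in> Hol X \<A> Y \<B>. f ` K \<subseteq> W} | K W.
        K \<subseteq> X \<and> compact K \<and> openin (top_of_set Y) W}"

section \<open>Hyperbolic Riemann surfaces and the Poincar\'e distance\<close>

abbreviation unit_disc :: "complex set" where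
  "unit_disc \<equiv> ball 0 1"

abbreviation unit_disc_atlas :: "complex chart set" where
  "unit_disc_atlas \<equiv> {(unit_disc, \<lambda>z. z)}"

text \<open>Since the disc is simply connected, every holomorphic covering by it is universal.\<close>

definition disc_covering ::
    "'a::topological_space set \<Rightarrow> 'a chart set \<Rightarrow> (complex \<Rightarrow> 'a) \<Rightarrow> bool" where
  "disc_covering X \<A> p \<longleftrightarrow>
     p \<in> Hol unit_disc unit_disc_atlas X \<A> \<and> covering_space unit_disc p X"

definition hyperbolic_surface :: "'a::topological_space set \<Rightarrow> 'a chart set \<Rightarrow> bool" where
  "hyperbolic_surface X \<A> \<longleftrightarrow> riemann_surface X \<A> \<and> (\<exists>p. disc_covering X \<A> p)"

text \<open>The distance of the Poincar\'e metric \<open>\<bar>dz\<bar> / (1 - \<bar>z\<bar>\<^sup>2)\<close>, of curvature \<open>-4\<close>. Another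
  normalisation would multiply all the distances by a constant.\<close>

definition disc_dist :: "complex \<Rightarrow> complex \<Rightarrow> real" where
  "disc_dist a b = artanh (cmod ((a - b) / (1 - cnj a * b)))"

text \<open>The universal covering is unique up to automorphisms of the disc, which are isometries of
  \<^const>\<open>disc_dist\<close>, so the choice of the covering does not affect the distance.\<close>

definition poincare_dist :: "'a::topological_space set \<Rightarrow> 'a chart set \<Rightarrow> 'a \<Rightarrow> 'a \<Rightarrow> real" where
  "poincare_dist X \<A> x y =
     (let p = (SOME p. disc_covering X \<A> p)
      in Inf {disc_dist a b | a b. a \<in> unit_disc \<and> b \<in> unit_disc \<and> p a = x \<and> p b = y})"

definition poincare_ball :: "'a::topological_space set \<Rightarrow> 'a chart set \<Rightarrow> 'a \<Rightarrow> real \<Rightarrow> 'a set" where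
  "poincare_ball X \<A> z r = {w \<in> X. poincare_dist X \<A> z w < r}"

section \<open>Bloch domains and left iterated function systems\<close>

definition bloch_radius :: "'a::topological_space set \<Rightarrow> 'a set \<Rightarrow> 'a chart set \<Rightarrow> ereal" where
  "bloch_radius \<Omega> X \<A> = Sup {ereal r | r. r > 0 \<and> (\<exists>z\<in>\<Omega>. poincare_ball X \<A> z r \<subseteq> \<Omega>)}"

definition bloch_domain :: "'a::topological_space set \<Rightarrow> 'a set \<Rightarrow> 'a chart set \<Rightarrow> bool" where
  "bloch_domain \<Omega> X \<A> \<longleftrightarrow>
     \<Omega> \<noteq> {} \<and> connected \<Omega> \<and> openin (top_of_set X) \<Omega> \<and> bloch_radius \<Omega> X \<A> < \<infinity>"

primrec left_ifs :: "(nat \<Rightarrow> 'a \<Rightarrow> 'a) \<Rightarrow> nat \<Rightarrow> 'a \<Rightarrow> 'a" where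
  "left_ifs f 0 = f 0"
| "left_ifs f (Suc \<nu>) = f (Suc \<nu>) \<circ> left_ifs f \<nu>"

end

theory Submission
  imports Defs
begin

text \<open>Lift each \<open>f \<nu>\<close> to a self-map \<open>F\<close> of the disc through the covering \<open>p\<close>. Its image stays in the preimage of
  \<open>\<Omega>\<close>, and the Bloch condition says that every point of this preimage is within a bounded distance \<open>R\<close> of a
  point that \<open>F\<close> omits. Such an \<open>F\<close> factors through the squaring map up to Moebius transformations, so it is
  a contraction at small scale with a constant that depends on \<open>R\<close> only, and subdivision of geodesics makes
  this a contraction at every scale. Hence all \<open>f \<nu>\<close> contract the Poincare distance of \<open>X\<close> by the same
  factor \<open>k < 1\<close>. Both claims are then metric: \<open>left_ifs f \<nu>\<close> shrinks distances by \<open>k ^ Suc \<nu>\<close>, and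
  its values and the fixed points \<open>z \<nu>\<close> control each other through the triangle inequality.\<close>

section \<open>The pseudohyperbolic distance of the disc\<close>

text \<open>A map that omits \<open>v\<close> is, after a Moebius change of coordinates sending
  \<open>v\<close> to \<open>0\<close>, the square of a holomorphic self-map \<open>h\<close> of the
  disc. Schwarz-Pick controls \<open>h\<close>, and squaring multiplies the pseudohyperbolic
  distance of \<open>h a\<close> and \<open>h b\<close> by that of \<open>- h a\<close> and
  \<open>h b\<close>. This second factor stays away from 1 only while \<open>h a\<close> stays in a
  fixed compact part of the disc, which is where the bound \<open>R\<close> enters, and while
  \<open>b\<close> stays near \<open>a\<close>. Hence the estimate is made at a fixed scale,
  distance 1, and has to be subdivided afterwards. The algebra is simple for the pseudohyperbolic
  distance, but only its \<open>artanh\<close> is additive along geodesics, so the factor must be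
  carried over from one to the other. Factors below 1 that depend on the map could have a product
  that does not tend to 0, so one \<open>k\<close> must be found before any map is chosen. The fixed
  points are constructed as well: a lift maps a large closed hyperbolic ball about \<open>0\<close>
  into itself, this ball is a Euclidean disc, and Brouwer's theorem applies.\<close>

definition pseudo_dist :: "complex \<Rightarrow> complex \<Rightarrow> real" where
  "pseudo_dist a b = cmod ((a - b) / (1 - cnj a * b))"

lemma disc_dist_eq: "disc_dist a b = artanh (pseudo_dist a b)"
  by (simp add: disc_dist_def pseudo_dist_def)

lemma pseudo_dist_nonneg [simp]: "0 \<le> pseudo_dist a b"
  by (simp add: pseudo_dist_def)

lemma pseudo_dist_refl [simp]: "pseudo_dist a a = 0"
  by (simp add: pseudo_dist_def)

lemma pseudo_dist_0 [simp]: "pseudo_dist 0 a = cmod a"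
  by (simp add: pseudo_dist_def)

lemma pseudo_dist_commute: "pseudo_dist a b = pseudo_dist b a"
proof -
  have "cmod (1 - cnj a * b) = cmod (cnj (1 - cnj a * b))"
    by (simp only: complex_mod_cnj)
  also have "\<dots> = cmod (1 - cnj b * a)"
    by (simp add: mult.commute)
  finally show ?thesis
    by (simp add: pseudo_dist_def norm_divide norm_minus_commute)
qed

lemma pseudo_dist_Moebius: "pseudo_dist a b = cmod (Moebius_function 0 a b)"
  by (simp add: pseudo_dist_def Moebius_function_simple norm_divide norm_minus_commute)

lemma pseudo_dist_less_1:
  assumes "a \<in> unit_disc" "b \<in> unit_disc"
  shows "pseudo_dist a b < 1"
  using assms Moebius_function_norm_lt_1 by (simp add: pseudo_dist_Moebius)

lemma Moebius_function_in_disc: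
  assumes "a \<in> unit_disc" "b \<in> unit_disc"
  shows "Moebius_function 0 a b \<in> unit_disc"
  using assms Moebius_function_norm_lt_1 by simp

lemma one_minus_cnj_mult_nonzero:
  assumes "a \<in> unit_disc" "b \<in> unit_disc"
  shows "1 - cnj a * b \<noteq> 0"
proof
  assume "1 - cnj a * b = 0"
  then have "cmod a * cmod b = 1"
    by (metis complex_mod_cnj eq_iff_diff_eq_0 norm_mult norm_one)
  with assms show False
    by (metis mem_ball_0 mult.commute norm_mult norm_mult_less less_irrefl mult_1)
qed

lemma pseudo_dist_eq_0_iff:
  assumes "a \<in> unit_disc" "b \<in> unit_disc"
  shows "pseudo_dist a b = 0 \<longleftrightarrow> a = b"
  using one_minus_cnj_mult_nonzero[OF assms] by (simp add: pseudo_dist_def)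

text \<open>Moebius transformations before and after \<open>F\<close> move both \<open>a\<close> and
  \<open>F a\<close> to \<open>0\<close>, where the Schwarz lemma applies.\<close>

lemma Schwarz_Pick:
  assumes hol: "F holomorphic_on unit_disc" and im: "F ` unit_disc \<subseteq> unit_disc"
    and a: "a \<in> unit_disc" and b: "b \<in> unit_disc"
  shows "pseudo_dist (F a) (F b) \<le> pseudo_dist a b"
proof -
  define G where "G = Moebius_function 0 (F a) \<circ> F \<circ> Moebius_function 0 (- a)"
  have Fa: "F a \<in> unit_disc"
    using a im by blast
  have Ma: "Moebius_function 0 (- a) ` unit_disc \<subseteq> unit_disc"
    using a Moebius_function_in_disc[of "- a"] by auto
  have "Moebius_function 0 (F a) \<circ> F holomorphic_on unit_disc"
    using Fa by (intro holomorphic_on_compose_gen[OF hol _ im] Moebius_function_holomorphic) auto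
  then have holG: "G holomorphic_on unit_disc"
    unfolding G_def using a
    by (intro holomorphic_on_compose_gen[OF _ _ Ma] Moebius_function_holomorphic) auto
  have G0: "G 0 = 0"
    by (simp add: G_def Moebius_function_of_zero Moebius_function_eq_zero)
  have Gless: "cmod (G z) < 1" if "cmod z < 1" for z
  proof -
    have "F (Moebius_function 0 (- a) z) \<in> unit_disc"
      using that Ma im by (meson image_subset_iff mem_ball_0)
    then show ?thesis
      using Moebius_function_in_disc[OF Fa] by (simp add: G_def)
  qed
  have "cmod (G (Moebius_function 0 a b)) \<le> cmod (Moebius_function 0 a b)"
    using Schwarz_Lemma(1)[OF holG G0 Gless] Moebius_function_in_disc[OF a b] by simp
  moreover have "G (Moebius_function 0 a b) = Moebius_function 0 (F a) (F b)"
    using a b Moebius_function_compose[of a "-a" b] Moebius_function_compose[of "-a" a b] by (simp add: G_def)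
  ultimately show ?thesis
    by (simp add: pseudo_dist_Moebius)
qed

text \<open>Schwarz-Pick for the Moebius transformation gives one inequality and for its inverse,
  the one with parameter \<open>- c\<close>, the other.\<close>

lemma pseudo_dist_Moebius_invariant:
  assumes c: "c \<in> unit_disc" and a: "a \<in> unit_disc" and b: "b \<in> unit_disc"
  shows "pseudo_dist (Moebius_function 0 c a) (Moebius_function 0 c b) = pseudo_dist a b"
proof (rule antisym)
  have le: "pseudo_dist (Moebius_function 0 u x) (Moebius_function 0 u y) \<le> pseudo_dist x y"
    if "u \<in> unit_disc" "x \<in> unit_disc" "y \<in> unit_disc" for u x y
    using that Moebius_function_holomorphic[of u] Moebius_function_in_disc[of u]
    by (intro Schwarz_Pick) auto
  show "pseudo_dist (Moebius_function 0 c a) (Moebius_function 0 c b) \<le> pseudo_dist a b"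
    using le assms .
  have inv: "Moebius_function 0 (- c) (Moebius_function 0 c x) = x" if "x \<in> unit_disc" for x
    using that c Moebius_function_compose[of "- c" c x] by simp
  show "pseudo_dist a b \<le> pseudo_dist (Moebius_function 0 c a) (Moebius_function 0 c b)"
    using le[of "- c" "Moebius_function 0 c a" "Moebius_function 0 c b"] assms
    by (simp add: inv Moebius_function_in_disc Moebius_function_norm_lt_1)
qed

text \<open>This is the addition law of \<open>tanh\<close> (relativistic addition of velocities),
  the form that the triangle inequality takes before \<open>artanh\<close> is applied.\<close>

definition rel_add :: "real \<Rightarrow> real \<Rightarrow> real" where
  "rel_add s t = (s + t) / (1 + s * t)"

lemma rel_add_commute: "rel_add s t = rel_add t s"
  by (simp add: rel_add_def add.commute mult.commute)

lemma one_minus_rel_add: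
  assumes "0 \<le> s" "0 \<le> t"
  shows "1 - rel_add s t = (1 - s) * (1 - t) / (1 + s * t)"
proof -
  have "1 + s * t > 0" 
    using assms by (simp add: add_pos_nonneg)
  then show ?thesis 
    by (simp add: rel_add_def field_simps)
qed

lemma rel_add_less_1:
  assumes "0 \<le> s" "0 \<le> t" "s < 1" "t < 1"
  shows "rel_add s t < 1"
proof -
  have "(1 - s) * (1 - t) / (1 + s * t) > 0"
    using assms by (intro divide_pos_pos mult_pos_pos add_pos_nonneg) auto
  then show ?thesis
    using one_minus_rel_add[OF assms(1,2)] by linarith
qed

lemma rel_add_mono_left:
  assumes "0 \<le> s" "s \<le> s'" "0 \<le> t" "t \<le> 1"
  shows "rel_add s t \<le> rel_add s' t"
proof -
  have pos: "1 + s * t > 0" "1 + s' * t > 0"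
    using assms by (auto simp: add_pos_nonneg)
  have "0 \<le> (s' - s) * (1 - t * t)"
    using assms by (intro mult_nonneg_nonneg) (auto simp: mult_le_one)
  then have "(s + t) * (1 + s' * t) \<le> (s' + t) * (1 + s * t)"
    by (simp add: algebra_simps)
  then show ?thesis
    using pos by (simp add: rel_add_def divide_simps mult.commute)
qed

lemma rel_add_mono:
  assumes "0 \<le> s" "s \<le> s'" "s' \<le> 1" "0 \<le> t" "t \<le> t'" "t' \<le> 1"
  shows "rel_add s t \<le> rel_add s' t'"
  using rel_add_mono_left[of s s' t] rel_add_mono_left[of t t' s'] assms
  by (simp add: rel_add_commute[of s'])

text \<open>Subtracting the squares of both sides from 1 leaves fractions with the same numerator
  \<open>P\<close>; their denominators are the squares of \<open>D\<close> and of its upper bound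
  \<open>1 + cmod a * cmod c\<close>.\<close>

lemma pseudo_dist_triangle_0:
  assumes a: "a \<in> unit_disc" and c: "c \<in> unit_disc"
  shows "pseudo_dist a c \<le> rel_add (cmod a) (cmod c)"
proof -
  define D where "D = cmod (1 - cnj a * c)"
  have D: "0 < D" "D \<le> 1 + cmod a * cmod c"
    using one_minus_cnj_mult_nonzero[OF a c] norm_triangle_ineq4[of 1 "cnj a * c"]
    by (auto simp: D_def norm_mult)
  have D2: "D\<^sup>2 = (cmod (a - c))\<^sup>2 + (1 - (cmod a)\<^sup>2) * (1 - (cmod c)\<^sup>2)"
    unfolding D_def cmod_power2 by (simp add: algebra_simps power2_eq_square)
  have E: "(1 + cmod a * cmod c)\<^sup>2 = (cmod a + cmod c)\<^sup>2 + (1 - (cmod a)\<^sup>2) * (1 - (cmod c)\<^sup>2)"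
    by (simp add: algebra_simps power2_eq_square)
  define P where "P = (1 - (cmod a)\<^sup>2) * (1 - (cmod c)\<^sup>2)"
  have P: "0 \<le> P"
    using a c unfolding P_def by (intro mult_nonneg_nonneg) (auto simp: power_le_one)
  have pos: "1 + cmod a * cmod c > 0"
    by (simp add: add_pos_nonneg)
  have "P / (1 + cmod a * cmod c)\<^sup>2 \<le> P / D\<^sup>2"
    using D P pos by (intro divide_left_mono power_mono) auto
  moreover have "(pseudo_dist a c)\<^sup>2 = 1 - P / D\<^sup>2"
    using D(1) D2 by (simp add: pseudo_dist_def norm_divide power_divide P_def D_def field_simps)
  moreover have "(rel_add (cmod a) (cmod c))\<^sup>2 = 1 - P / (1 + cmod a * cmod c)\<^sup>2"
    using pos E by (simp add: rel_add_def power_divide P_def field_simps)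
  ultimately have "(pseudo_dist a c)\<^sup>2 \<le> (rel_add (cmod a) (cmod c))\<^sup>2"
    by linarith
  then show ?thesis
    by (rule power2_le_imp_le) (use pos in \<open>simp add: rel_add_def\<close>)
qed

lemma pseudo_dist_triangle:
  assumes "a \<in> unit_disc" "b \<in> unit_disc" "c \<in> unit_disc"
  shows "pseudo_dist a c \<le> rel_add (pseudo_dist a b) (pseudo_dist b c)"
proof -
  have "pseudo_dist a c = pseudo_dist (Moebius_function 0 b a) (Moebius_function 0 b c)"
    using assms by (simp only: pseudo_dist_Moebius_invariant)
  also have "\<dots> \<le> rel_add (cmod (Moebius_function 0 b a)) (cmod (Moebius_function 0 b c))"
    using assms by (intro pseudo_dist_triangle_0 Moebius_function_in_disc)
  finally show ?thesis
    by (simp add: pseudo_dist_Moebius[symmetric] pseudo_dist_commute)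
qed

section \<open>The Poincare distance of the disc\<close>

lemma tanh_artanh_real:
  fixes x :: real
  assumes "\<bar>x\<bar> < 1"
  shows "tanh (artanh x) = x"
proof -
  have "exp (- (2 * artanh x)) = (1 - x) / (1 + x)"
    using assms by (simp add: artanh_def exp_minus field_simps)
  then have e: "exp (- 2 * artanh x) = (1 - x) / (1 + x)"
    by simp
  show ?thesis
    using assms unfolding tanh_real_altdef e by (simp add: field_simps)
qed

lemma rel_add_tanh: "rel_add (tanh x) (tanh y) = tanh (x + y)"
  using tanh_add[of x y] by (simp add: rel_add_def)

lemma tanh_disc_dist:
  assumes "a \<in> unit_disc" "b \<in> unit_disc"
  shows "tanh (disc_dist a b) = pseudo_dist a b"
  using pseudo_dist_less_1[OF assms] by (simp add: disc_dist_eq tanh_artanh_real)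

lemma disc_dist_le_iff:
  assumes "a \<in> unit_disc" "b \<in> unit_disc"
  shows "disc_dist a b \<le> s \<longleftrightarrow> pseudo_dist a b \<le> tanh s"
  using tanh_disc_dist[OF assms] by (metis tanh_real_le_iff)

lemma disc_dist_less_iff:
  assumes "a \<in> unit_disc" "b \<in> unit_disc"
  shows "disc_dist a b < s \<longleftrightarrow> pseudo_dist a b < tanh s"
  using tanh_disc_dist[OF assms] by (metis tanh_real_less_iff)

lemma disc_dist_refl [simp]: "disc_dist a a = 0"
  by (simp add: disc_dist_eq)

lemma disc_dist_commute: "disc_dist a b = disc_dist b a"
  by (simp add: disc_dist_eq pseudo_dist_commute)

lemma disc_dist_nonneg:
  assumes "a \<in> unit_disc" "b \<in> unit_disc"
  shows "0 \<le> disc_dist a b"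
  using tanh_disc_dist[OF assms] pseudo_dist_nonneg[of a b] tanh_real_nonneg_iff[of "disc_dist a b"]
  by simp

lemma disc_dist_triangle:
  assumes "a \<in> unit_disc" "b \<in> unit_disc" "c \<in> unit_disc"
  shows "disc_dist a c \<le> disc_dist a b + disc_dist b c"
  using pseudo_dist_triangle[OF assms] assms
  by (simp add: disc_dist_le_iff flip: rel_add_tanh tanh_disc_dist)

lemma disc_dist_Schwarz_Pick:
  assumes "F holomorphic_on unit_disc" "F ` unit_disc \<subseteq> unit_disc"
    and "a \<in> unit_disc" "b \<in> unit_disc"
  shows "disc_dist (F a) (F b) \<le> disc_dist a b"
proof -
  have "F a \<in> unit_disc" "F b \<in> unit_disc"
    using assms(2-4) by blast+
  then show ?thesis
    using Schwarz_Pick[OF assms] assms(3,4) by (simp add: disc_dist_le_iff tanh_disc_dist)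
qed

lemma disc_dist_Moebius_invariant:
  assumes "c \<in> unit_disc" "a \<in> unit_disc" "b \<in> unit_disc"
  shows "disc_dist (Moebius_function 0 c a) (Moebius_function 0 c b) = disc_dist a b"
  using pseudo_dist_Moebius_invariant[OF assms] by (simp add: disc_dist_eq)

text \<open>The midpoint lies on the radius through \<open>b\<close>, so its distances to
  \<open>0\<close> and to \<open>b\<close> reduce to those of real numbers.\<close>

lemma disc_dist_midpoint_0:
  assumes b: "b \<in> unit_disc"
  obtains m where "m \<in> unit_disc" "disc_dist 0 m = disc_dist 0 b / 2" "disc_dist m b = disc_dist 0 b / 2"
proof (cases "b = 0")
  case True
  then show ?thesis
    using that[of 0] by simp
next
  case False
  define u where "u = tanh (disc_dist 0 b / 2)"
  define m where "m = (u / cmod b) *\<^sub>R b"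
  have u: "0 \<le> u" "u < 1"
    using disc_dist_nonneg[OF _ b, of 0] by (auto simp: u_def tanh_real_lt_1)
  \<comment> \<open>The doubling formula of \<open>tanh\<close>: \<open>u\<close> belongs to half
    the distance, \<open>cmod b\<close> to the whole.\<close>
  have "cmod b = rel_add u u"
    using tanh_disc_dist[OF _ b, of 0] by (simp add: u_def rel_add_tanh)
  then have bu: "cmod b * (1 + u * u) = 2 * u"
    using u by (simp add: rel_add_def field_simps add_nonneg_eq_0_iff)
  have nm: "cmod m = u"
    using False u by (simp add: m_def)
  have m: "m \<in> unit_disc"
    using nm u by simp
  have e1: "1 - cnj m * b = of_real (1 - u * cmod b)"
  proof -
    have "cnj b * b = of_real ((cmod b)\<^sup>2)"
      by (metis complex_norm_square mult.commute)
    then have "cnj m * b = of_real (u / cmod b * (cmod b)\<^sup>2)"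
      by (simp add: m_def scaleR_conv_of_real)
    then show ?thesis
      using False by (simp add: power2_eq_square)
  qed
  have "m - b = of_real (u / cmod b - 1) * b"
    by (simp add: m_def scaleR_conv_of_real algebra_simps)
  then have "cmod (m - b) = \<bar>u / cmod b - 1\<bar> * cmod b"
    by (simp only: norm_mult norm_of_real)
  also have "\<dots> = \<bar>(u / cmod b - 1) * cmod b\<bar>"
    by (simp add: abs_mult)
  also have "\<dots> = \<bar>u - cmod b\<bar>"
    using False by (simp add: left_diff_distrib)
  finally have e2: "cmod (m - b) = \<bar>u - cmod b\<bar>" .
  have lt: "u * cmod b < 1"
    using u b by (metis mem_ball_0 mult_less_cancel_right1 mult_strict_mono' norm_ge_zero mult_1 order_less_le)
  \<comment> \<open>Rewritten with \<open>bu\<close> and divided by \<open>1 + u * u\<close>, this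
    identity becomes \<open>key\<close>: the real points \<open>u\<close> and \<open>cmod b\<close>
    have pseudohyperbolic distance \<open>u\<close>.\<close>
  have "2 * u - u * (1 + u * u) = u * ((1 + u * u) - u * (2 * u))"
    by (simp add: algebra_simps)
  then have "cmod b * (1 + u * u) - u * (1 + u * u) = u * ((1 + u * u) - u * (cmod b * (1 + u * u)))"
    by (simp only: bu)
  then have "(cmod b - u) * (1 + u * u) = (u * (1 - u * cmod b)) * (1 + u * u)"
    by (simp add: algebra_simps)
  moreover have "1 + u * u \<noteq> 0"
    using u by (smt (verit) mult_nonneg_nonneg)
  ultimately have key: "cmod b - u = u * (1 - u * cmod b)"
    by simp
  then have "\<bar>u - cmod b\<bar> = u * (1 - u * cmod b)"
    using u lt by (smt (verit) mult_nonneg_nonneg)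
  then have "pseudo_dist m b = u"
    using lt unfolding pseudo_dist_def norm_divide e1 e2 by (simp only: norm_of_real) simp
  moreover have "pseudo_dist 0 m = u"
    using nm by simp
  ultimately show ?thesis
    using that[OF m] by (simp add: disc_dist_eq u_def artanh_tanh_real flip: disc_dist_eq)
      (simp add: disc_dist_eq u_def artanh_tanh_real)
qed

lemma disc_dist_midpoint:
  assumes a: "a \<in> unit_disc" and b: "b \<in> unit_disc"
  obtains m where "m \<in> unit_disc" "disc_dist a m = disc_dist a b / 2" "disc_dist m b = disc_dist a b / 2"
proof -
  have na: "- a \<in> unit_disc"
    using a by simp
  define b' where "b' = Moebius_function 0 a b"
  have b': "b' \<in> unit_disc"
    unfolding b'_def by (rule Moebius_function_in_disc[OF a b])
  obtain m' where m': "m' \<in> unit_disc" "disc_dist 0 m' = disc_dist 0 b' / 2" "disc_dist m' b' = disc_dist 0 b' / 2"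
    using disc_dist_midpoint_0[OF b'] .
  have "Moebius_function 0 (- a) 0 = a" "Moebius_function 0 (- a) b' = b"
    using Moebius_function_compose[of "- a" a b] a b
    by (auto simp: b'_def Moebius_function_of_zero)
  then show ?thesis
    using that[of "Moebius_function 0 (- a) m'"] m' b' Moebius_function_in_disc[OF na]
      disc_dist_Moebius_invariant[OF na, of 0 m'] disc_dist_Moebius_invariant[OF na, of 0 b']
      disc_dist_Moebius_invariant[OF na, of m' b']
    by simp
qed

section \<open>Maps omitting a nearby value\<close>

text \<open>Numerator and denominator both factor as differences of squares. The second factor on
  the right measures how far squaring is from being an isometry.\<close>

lemma pseudo_dist_power2:
  assumes "a \<in> unit_disc" "b \<in> unit_disc"
  shows "pseudo_dist (a\<^sup>2) (b\<^sup>2) = pseudo_dist a b * pseudo_dist (- a) b"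
proof -
  have "(a\<^sup>2 - b\<^sup>2) = - ((a - b) * (- a - b))" "1 - cnj (a\<^sup>2) * b\<^sup>2 = (1 - cnj a * b) * (1 - cnj (- a) * b)"
    by (auto simp: algebra_simps power2_eq_square)
  then show ?thesis
    by (simp add: pseudo_dist_def norm_mult norm_divide del: complex_cnj_minus complex_cnj_power)
qed

text \<open>The geodesic from \<open>- a\<close> to \<open>a\<close> passes through
  \<open>0\<close>, so here the triangle inequality is an equality.\<close>

lemma pseudo_dist_minus_self: "pseudo_dist (- a) a = rel_add (cmod a) (cmod a)"
proof -
  have "1 - cnj (- a) * a = of_real (1 + cmod a * cmod a)"
    by (simp add: complex_norm_square[symmetric] mult.commute[of "cnj a"] power2_eq_square[symmetric])
  moreover have "cmod (- a - a) = cmod a + cmod a"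
    by (metis minus_diff_eq minus_diff_minus mult_2 norm_minus_cancel norm_mult norm_numeral diff_minus_eq_add)
  moreover have "0 \<le> 1 + cmod a * cmod a"
    by simp
  ultimately show ?thesis
    unfolding pseudo_dist_def rel_add_def norm_divide by (simp only: norm_of_real abs_of_nonneg)
qed

text \<open>Composing \<open>F\<close> with a Moebius transformation moves the omitted value to \<open>0\<close>; then \<open>F\<close> factors
  through the squaring map, and the defect of the latter from being an isometry gives the gain.\<close>

lemma pseudo_dist_omit_le:
  assumes hol: "F holomorphic_on unit_disc" and im: "F ` unit_disc \<subseteq> unit_disc"
    and v: "v \<in> unit_disc" "v \<notin> F ` unit_disc"
    and a: "a \<in> unit_disc" and b: "b \<in> unit_disc"
    and s: "0 \<le> s" "s \<le> 1" "pseudo_dist (F a) v \<le> s\<^sup>2"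
  shows "pseudo_dist (F a) (F b) \<le> pseudo_dist a b * rel_add (rel_add s s) (pseudo_dist a b)"
proof -
  define G where "G = Moebius_function 0 v \<circ> F"
  have Gim: "G z \<in> unit_disc" if "z \<in> unit_disc" for z
    using that im Moebius_function_in_disc[OF v(1)] unfolding G_def o_def by blast
  have holG: "G holomorphic_on unit_disc"
    unfolding G_def using hol im v(1)
    by (intro holomorphic_on_compose_gen[OF _ Moebius_function_holomorphic]) auto
  have Gnz: "G z \<noteq> 0" if "z \<in> unit_disc" for z
  proof -
    have "F z \<in> unit_disc" "F z \<noteq> v"
      using that im v by blast+
    then have "pseudo_dist v (F z) \<noteq> 0"
      using pseudo_dist_eq_0_iff[OF v(1)] by metis
    then show ?thesis
      by (simp add: G_def pseudo_dist_Moebius)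
  qed
  \<comment> \<open>A zero-free holomorphic function on a contractible domain has a holomorphic
    square root.\<close>
  obtain h where holh: "h holomorphic_on unit_disc" and h: "\<And>z. z \<in> unit_disc \<Longrightarrow> G z = (h z)\<^sup>2"
    using contractible_imp_holomorphic_sqrt[OF holG _ Gnz] convex_imp_contractible[of unit_disc] by auto
  have him: "h z \<in> unit_disc" if "z \<in> unit_disc" for z
  proof -
    have "(cmod (h z))\<^sup>2 < 1"
      using Gim[OF that] h[OF that] by (simp add: norm_power)
    then show ?thesis
      using power_less_imp_less_base[of "cmod (h z)" 2 1] by simp
  qed
  define t where "t = pseudo_dist a b"
  have t: "0 \<le> t" "t < 1"
    using pseudo_dist_less_1[OF a b] by (auto simp: t_def)
  have hab: "pseudo_dist (h a) (h b) \<le> t"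
    unfolding t_def using him by (intro Schwarz_Pick holh a b) auto
  \<comment> \<open>Because \<open>h\<close> is a square root, a bound for the distance of
    \<open>F a\<close> to \<open>v\<close> bounds the square of \<open>cmod (h a)\<close>; this is
    why the hypothesis is stated with a square.\<close>
  have "(cmod (h a))\<^sup>2 \<le> s\<^sup>2"
  proof -
    have "(cmod (h a))\<^sup>2 = pseudo_dist v (F a)"
      using h[OF a] by (metis G_def comp_apply norm_power pseudo_dist_Moebius)
    then show ?thesis
      using s by (simp add: pseudo_dist_commute)
  qed
  then have "cmod (h a) \<le> s"
    using s(1) by (rule power2_le_imp_le)
  then have 1: "rel_add (cmod (h a)) (cmod (h a)) \<le> rel_add s s"
    using s by (intro rel_add_mono) auto
  have s1: "rel_add s s \<le> 1"
    using one_minus_rel_add[of s s] s by (smt (verit) divide_nonneg_nonneg mult_nonneg_nonneg)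
  have nh: "- h a \<in> unit_disc"
    using him[OF a] by simp
  \<comment> \<open>The path from \<open>- h a\<close> to \<open>h b\<close> goes through
    \<open>h a\<close>: the first leg is bounded through \<open>s\<close>, the second by
    Schwarz-Pick for \<open>h\<close>.\<close>
  have "pseudo_dist (- h a) (h b) \<le> rel_add (pseudo_dist (- h a) (h a)) (pseudo_dist (h a) (h b))"
    using nh him a b by (intro pseudo_dist_triangle) auto
  also have "\<dots> \<le> rel_add (rel_add s s) t"
    using 1 s1 hab t by (intro rel_add_mono) (auto simp: pseudo_dist_minus_self[symmetric])
  finally have 2: "pseudo_dist (- h a) (h b) \<le> rel_add (rel_add s s) t" .
  have "pseudo_dist (F a) (F b) = pseudo_dist (G a) (G b)"
    unfolding G_def o_def using im a b by (intro pseudo_dist_Moebius_invariant[symmetric] v(1)) blast+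
  also have "\<dots> = pseudo_dist (h a) (h b) * pseudo_dist (- h a) (h b)"
    using pseudo_dist_power2 him a b h by simp
  also have "\<dots> \<le> t * rel_add (rel_add s s) t"
    using hab 2 t by (intro mult_mono) auto
  finally show ?thesis
    by (simp add: t_def)
qed

text \<open>This is convexity of \<open>artanh\<close> on \<open>[0, 1)\<close> together with
  \<open>artanh 0 = 0\<close>. It turns a factor for \<open>pseudo_dist\<close> into the same factor
  for \<open>disc_dist\<close>.\<close>

lemma artanh_mult_le:
  fixes k t :: real
  assumes k: "0 \<le> k" "k \<le> 1" and t: "0 \<le> t" "t < 1"
  shows "artanh (k * t) \<le> k * artanh t"
proof -
  have kx: "\<bar>k * x\<bar> < 1" "\<bar>x\<bar> < 1" "(k * x)\<^sup>2 \<le> x\<^sup>2" "x\<^sup>2 < 1" if "0 \<le> x" "x \<le> t" for x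
  proof -
    have "k * x \<le> 1 * x"
      using k that by (intro mult_right_mono) auto
    then show "\<bar>k * x\<bar> < 1" "\<bar>x\<bar> < 1" "(k * x)\<^sup>2 \<le> x\<^sup>2" "x\<^sup>2 < 1"
      using that t k by (auto intro!: power_mono simp: abs_mult power_less_one_iff abs_square_less_1)
  qed
  have "k * artanh 0 - artanh (k * 0) \<le> k * artanh t - artanh (k * t)"
  proof (rule DERIV_nonneg_imp_nondecreasing[OF t(1), of "\<lambda>x. k * artanh x - artanh (k * x)"])
    fix x assume x: "0 \<le> x" "x \<le> t"
    have "((\<lambda>x. k * artanh x - artanh (k * x)) has_field_derivative
            k * (1 / (1 - x\<^sup>2)) - 1 / (1 - (k * x)\<^sup>2) * k) (at x)"
      using kx[OF x] by (auto intro!: derivative_eq_intros DERIV_chain2[of artanh])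
    moreover have "1 / (1 - (k * x)\<^sup>2) \<le> 1 / (1 - x\<^sup>2)"
      using kx[OF x] by (intro divide_left_mono) auto
    then have "0 \<le> k * (1 / (1 - x\<^sup>2)) - 1 / (1 - (k * x)\<^sup>2) * k"
      using k mult_left_mono[of "1 / (1 - (k * x)\<^sup>2)" "1 / (1 - x\<^sup>2)" k] by (simp add: mult.commute)
    ultimately show "\<exists>y. ((\<lambda>x. k * artanh x - artanh (k * x)) has_real_derivative y) (at x) \<and> 0 \<le> y"
      by blast
  qed
  then show ?thesis
    by simp
qed

text \<open>Midpoints split the distance into two exact halves, so the bounds for the halves add up
  with the same \<open>k\<close>; each halving doubles the range of distances covered.\<close>

lemma contraction_of_local_contraction:
  assumes im: "F ` unit_disc \<subseteq> unit_disc"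
    and local: "\<And>a b. a \<in> unit_disc \<Longrightarrow> b \<in> unit_disc \<Longrightarrow> disc_dist a b \<le> 1 \<Longrightarrow>
      disc_dist (F a) (F b) \<le> k * disc_dist a b"
    and a: "a \<in> unit_disc" and b: "b \<in> unit_disc"
  shows "disc_dist (F a) (F b) \<le> k * disc_dist a b"
proof -
  have "disc_dist (F a) (F b) \<le> k * disc_dist a b"
    if "a \<in> unit_disc" "b \<in> unit_disc" "disc_dist a b \<le> 2 ^ n" for a b n
    using that
  proof (induction n arbitrary: a b)
    case 0
    then show ?case
      by (simp add: local)
  next
    case (Suc n)
    obtain m where m: "m \<in> unit_disc" "disc_dist a m = disc_dist a b / 2" "disc_dist m b = disc_dist a b / 2"
      using disc_dist_midpoint[OF Suc.prems(1,2)] .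
    have "disc_dist (F a) (F b) \<le> disc_dist (F a) (F m) + disc_dist (F m) (F b)"
      using im m(1) Suc.prems(1,2) by (intro disc_dist_triangle) blast+
    also have "\<dots> \<le> k * disc_dist a m + k * disc_dist m b"
      using m Suc.prems by (intro add_mono Suc.IH) auto
    finally show ?case
      by (simp add: m)
  qed
  moreover obtain n where "disc_dist a b < 2 ^ n"
    using real_arch_pow[of 2] by auto
  ultimately show ?thesis
    using a b less_imp_le by blast
qed

text \<open>The order of quantifiers is the point: \<open>k\<close> depends on \<open>R\<close>
  alone, while the omitted value \<open>v\<close> may change with \<open>F\<close> and with
  \<open>a\<close>.\<close>

lemma disc_contraction_of_omitted_values:
  assumes "0 < R"
  obtains k where "0 < k" "k < 1"
    "\<And>F a b. \<lbrakk>F holomorphic_on unit_disc; F ` unit_disc \<subseteq> unit_disc;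
       \<And>a. a \<in> unit_disc \<Longrightarrow> \<exists>v\<in>unit_disc - F ` unit_disc. disc_dist (F a) v \<le> R;
       a \<in> unit_disc; b \<in> unit_disc\<rbrakk> \<Longrightarrow> disc_dist (F a) (F b) \<le> k * disc_dist a b"
proof -
  \<comment> \<open>An omitted value within distance \<open>R\<close> of \<open>F a\<close> has
    pseudohyperbolic distance at most \<open>tanh R\<close>, the square of \<open>s\<close>, as
    \<open>pseudo_dist_omit_le\<close> requires.\<close>
  define s where "s = sqrt (tanh R)"
  have s: "0 \<le> s" "s < 1" "s\<^sup>2 = tanh R"
    using assms tanh_real_lt_1[of R] by (auto simp: s_def)
  define A where "A = rel_add s s"
  have A: "0 \<le> A" "A < 1"
    using s rel_add_less_1[of s s] by (auto simp: A_def rel_add_def)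
  \<comment> \<open>The factor gained at pseudohyperbolic distance \<open>t\<close> is
    \<open>rel_add A t\<close>; for points at Poincare distance at most 1 its worst case is
    \<open>t = tanh 1\<close>.\<close>
  define k where "k = rel_add A (tanh 1)"
  have T: "0 < tanh (1::real)" "tanh (1::real) < 1"
    using tanh_real_lt_1 by auto
  have k: "0 < k" "k < 1"
    using A T rel_add_less_1[of A "tanh 1"]
    by (auto simp: k_def rel_add_def intro!: divide_pos_pos add_nonneg_pos[of A] add_pos_nonneg[of 1])
  show ?thesis
  proof (rule that[OF k])
    fix F a b
    assume hol: "F holomorphic_on unit_disc" and im: "F ` unit_disc \<subseteq> unit_disc"
      and omit: "\<And>a. a \<in> unit_disc \<Longrightarrow> \<exists>v\<in>unit_disc - F ` unit_disc. disc_dist (F a) v \<le> R"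
      and ab: "a \<in> unit_disc" "b \<in> unit_disc"
    show "disc_dist (F a) (F b) \<le> k * disc_dist a b"
    proof (rule contraction_of_local_contraction[OF im _ ab])
      fix a b assume ab: "a \<in> unit_disc" "b \<in> unit_disc" and le: "disc_dist a b \<le> 1"
      obtain v where v: "v \<in> unit_disc" "v \<notin> F ` unit_disc" "disc_dist (F a) v \<le> R"
        using omit[OF ab(1)] by auto
      have F: "F a \<in> unit_disc" "F b \<in> unit_disc"
        using ab im by blast+
      define t where "t = pseudo_dist a b"
      have t: "0 \<le> t" "t < 1" "t \<le> tanh 1"
        using pseudo_dist_less_1[OF ab] le ab by (auto simp: t_def disc_dist_le_iff)
      have "pseudo_dist (F a) v \<le> s\<^sup>2"
        using v F by (simp add: s(3) disc_dist_le_iff)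
      then have "pseudo_dist (F a) (F b) \<le> t * rel_add A t"
        unfolding A_def t_def using s ab v by (intro pseudo_dist_omit_le hol im) auto
      also have "\<dots> \<le> t * k"
        unfolding k_def using A t T by (intro mult_left_mono rel_add_mono) auto
      finally have "pseudo_dist (F a) (F b) \<le> k * t"
        by (simp add: mult.commute)
      moreover have "k * t < 1"
        using k t by (smt (verit) mult_left_le_one_le)
      ultimately have "disc_dist (F a) (F b) \<le> artanh (k * t)"
        using F k t by (simp add: disc_dist_le_iff tanh_artanh_real abs_mult)
      also have "\<dots> \<le> k * artanh t"
        using k t by (intro artanh_mult_le) auto
      finally show "disc_dist (F a) (F b) \<le> k * disc_dist a b"
        by (simp add: t_def disc_dist_eq)
    qed
  qed
qed

section \<open>Lifting through a covering by the disc\<close>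

text \<open>\<open>E\<close> is the fibre product of \<open>h\<close> and \<open>p\<close>. A
  neighbourhood \<open>T\<close> evenly covered by \<open>p\<close> pulls back to \<open>T'\<close>,
  and each sheet \<open>u\<close> over \<open>T\<close> yields the sheet of those points of
  \<open>E\<close> that lie in \<open>T' \<times> u\<close>.\<close>

lemma covering_space_pullback:
  fixes h :: "'c::topological_space \<Rightarrow> 'b::topological_space" and p :: "'a::topological_space \<Rightarrow> 'b"
  assumes cov: "covering_space C p S" and h: "continuous_on B h" "h ` B \<subseteq> S"
  defines "E \<equiv> {e \<in> B \<times> C. h (fst e) = p (snd e)}"
  shows "covering_space E fst B"
proof
  have E_iff: "(z, w) \<in> E \<longleftrightarrow> z \<in> B \<and> w \<in> C \<and> h z = p w" for z w
    by (simp add: E_def)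
  show "continuous_on E fst"
    by (rule continuous_on_fst[OF continuous_on_id])
  have "z \<in> fst ` E" if "z \<in> B" for z
  proof -
    have "h z \<in> p ` C"
      using h(2) imageI[OF that, of h] unfolding covering_space_imp_surjective[OF cov] by (rule subsetD)
    then obtain w where "w \<in> C" "h z = p w"
      by (rule imageE)
    with that have "(z, w) \<in> E"
      by (simp add: E_iff)
    then show ?thesis
      by (intro image_eqI[of _ fst "(z, w)"]) simp_all
  qed
  then show "fst ` E = B"
    by (auto simp: E_iff)
  fix z assume z: "z \<in> B"
  then have "h z \<in> S"
    using h(2) by blast
  then obtain T v where T: "h z \<in> T" "openin (top_of_set S) T" "\<Union>v = C \<inter> p -` T"
      "\<And>u. u \<in> v \<Longrightarrow> openin (top_of_set C) u" "pairwise disjnt v"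
      and hom: "\<And>u. u \<in> v \<Longrightarrow> \<exists>q. homeomorphism u T p q"
    using cov unfolding covering_space_def by metis
  define T' where "T' = B \<inter> h -` T"
  define v' where "v' = (\<lambda>u. E \<inter> (T' \<times> u)) ` v"
  have oT': "openin (top_of_set B) T'"
    unfolding T'_def using continuous_openin_preimage[OF h(1) _ T(2)] h(2) by auto
  have "\<Union>v' = E \<inter> fst -` T'"
  proof (rule set_eqI)
    fix e :: "'c \<times> 'a"
    obtain z w where e: "e = (z, w)"
      by fastforce
    have "w \<in> \<Union>v" if "(z, w) \<in> E" "z \<in> T'"
      using that unfolding T(3) by (simp add: E_iff T'_def)
    then show "e \<in> \<Union>v' \<longleftrightarrow> e \<in> E \<inter> fst -` T'"
      by (auto simp: e v'_def)
  qed
  moreover have "openin (top_of_set E) u'" if u': "u' \<in> v'" for u'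
  proof -
    obtain u where u: "u \<in> v" "u' = E \<inter> (T' \<times> u)"
      using u' unfolding v'_def by blast
    obtain T1 u1 where "open T1" "T' = B \<inter> T1" "open u1" "u = C \<inter> u1"
      using oT' T(4)[OF u(1)] by (auto simp: openin_open)
    then have "u' = E \<inter> (T1 \<times> u1)"
      using u(2) by (auto simp: E_iff)
    then show ?thesis
      using \<open>open T1\<close> \<open>open u1\<close> open_Times openin_open by blast
  qed
  moreover have "pairwise disjnt v'"
    using T(5) unfolding v'_def pairwise_def disjnt_def by blast
  moreover have "\<exists>q. homeomorphism u' T' fst q" if u': "u' \<in> v'" for u'
  proof -
    obtain u where u: "u \<in> v" "u' = E \<inter> (T' \<times> u)"
      using u' unfolding v'_def by blast
    obtain q where q: "homeomorphism u T p q"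
      using hom[OF u(1)] by blast
    have uC: "u \<subseteq> C"
      using T(4)[OF u(1)] openin_imp_subset by blast
    \<comment> \<open>The inverse of the projection on a sheet feeds \<open>h z\<close> to the local
      inverse \<open>q\<close> of \<open>p\<close>.\<close>
    have "homeomorphism u' T' fst (\<lambda>z. (z, q (h z)))"
    proof (intro homeomorphismI)
      show "continuous_on u' fst"
        by (rule continuous_on_fst[OF continuous_on_id])
      have "continuous_on T' (q \<circ> h)"
        using h(1) homeomorphism_cont2[OF q]
        by (intro continuous_on_compose) (auto simp: T'_def intro: continuous_on_subset)
      then show "continuous_on T' (\<lambda>z. (z, q (h z)))"
        by (intro continuous_on_Pair continuous_on_id) (simp add: o_def)
      show "fst ` u' \<subseteq> T'"
        using u by auto
      show "(\<lambda>z. (z, q (h z))) ` T' \<subseteq> u'"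
      proof (intro image_subsetI)
        fix z assume z: "z \<in> T'"
        then have "h z \<in> T" "z \<in> B"
          by (auto simp: T'_def)
        then have "q (h z) \<in> u" "p (q (h z)) = h z"
          using q by (auto simp: homeomorphism_def)
        with z \<open>z \<in> B\<close> uC show "(z, q (h z)) \<in> u'"
          by (auto simp: u E_iff)
      qed
      show "(fst x, q (h (fst x))) = x" if "x \<in> u'" for x
        using that q by (auto simp: u E_iff homeomorphism_def)
    qed auto
    then show ?thesis
      by blast
  qed
  ultimately show "\<exists>T. z \<in> T \<and> openin (top_of_set B) T \<and>
          (\<exists>v. \<Union>v = E \<inter> fst -` T \<and> (\<forall>u\<in>v. openin (top_of_set E) u) \<and>
            pairwise disjnt v \<and> (\<forall>u\<in>v. \<exists>q. homeomorphism u T fst q))"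
    using z T(1) oT' by (intro exI[of _ T'] conjI exI[of _ v']) (auto simp: T'_def)
qed

text \<open>The lifting theorem of the library assumes that the base is a subset of a normed space. Lifting \<open>h\<close> amounts to
  finding a section of the pullback covering, whose base is the domain of \<open>h\<close>.\<close>

lemma covering_space_lift_topological:
  fixes h :: "'c::real_normed_vector \<Rightarrow> 'b::topological_space" and p :: "'a::real_normed_vector \<Rightarrow> 'b"
  assumes cov: "covering_space C p S"
    and B: "simply_connected B" "locally path_connected B"
    and h: "continuous_on B h" "h ` B \<subseteq> S" and z: "z \<in> B" and a: "a \<in> C" "h z = p a"
  obtains g where "continuous_on B g" "g ` B \<subseteq> C" "g z = a" "\<And>y. y \<in> B \<Longrightarrow> p (g y) = h y"
proof -
  define E where "E = {e \<in> B \<times> C. h (fst e) = p (snd e)}"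
  have E: "(z, a) \<in> E"
    using z a by (simp add: E_def)
  obtain G where G: "continuous_on B G" "G \<in> B \<rightarrow> E" "G z = (z, a)" "\<And>y. y \<in> B \<Longrightarrow> fst (G y) = y"
    using covering_space_lift_strong[OF covering_space_pullback[OF cov h, folded E_def] E z B
        continuous_on_id[unfolded id_def, of B]]
    by auto
  have GE: "snd (G y) \<in> C \<and> h y = p (snd (G y))" if "y \<in> B" for y
  proof -
    have "G y \<in> E"
      using G(2) that by (rule funcset_mem)
    then show ?thesis
      using G(4)[OF that] by (auto simp: E_def)
  qed
  show ?thesis
  proof (rule that[of "snd \<circ> G"])
    show "continuous_on B (snd \<circ> G)"
      using G(1) by (intro continuous_on_compose continuous_on_snd[OF continuous_on_id])
  qed (use GE G in auto)
qed

text \<open>Coverings are local homeomorphisms, hence open. This will show that metric balls of the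
  surface, being images of balls of the disc, are open.\<close>

lemma openin_covering_image:
  fixes p :: "'a::topological_space \<Rightarrow> 'b::topological_space"
  assumes cov: "covering_space C p S" and U: "openin (top_of_set C) U"
  shows "openin (top_of_set S) (p ` U)"
proof (subst openin_subopen, intro ballI)
  fix y assume "y \<in> p ` U"
  then obtain x where x: "x \<in> U" "y = p x"
    by blast
  then have "x \<in> C"
    using U openin_imp_subset by blast
  then obtain T u q where T: "x \<in> T" "openin (top_of_set C) T" "p x \<in> u" "openin (top_of_set S) u"
      "homeomorphism T u p q"
    using covering_space_local_homeomorphism[OF cov] by metis
  have "openin (top_of_set C) (T \<inter> U)"
    using T(2) U by blast
  then have "openin (top_of_set T) (T \<inter> U)"
    by (rule openin_subset_trans) (use T(2) openin_imp_subset in auto)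
  then have "openin (top_of_set u) (p ` (T \<inter> U))"
    by (rule homeomorphism_imp_open_map[OF T(5)])
  then have "openin (top_of_set S) (p ` (T \<inter> U))"
    using T(4) openin_trans by blast
  then show "\<exists>V. openin (top_of_set S) V \<and> y \<in> V \<and> V \<subseteq> p ` U"
    using x T(1) by blast
qed

section \<open>Holomorphic maps between surfaces\<close>

lemma Hol_continuous: "f \<in> Hol X \<A> Y \<B> \<Longrightarrow> continuous_on X f"
  and Hol_image: "f \<in> Hol X \<A> Y \<B> \<Longrightarrow> f ` X \<subseteq> Y"
  and Hol_chart: "f \<in> Hol X \<A> Y \<B> \<Longrightarrow> (U, \<phi>) \<in> \<A> \<Longrightarrow> (V, \<psi>) \<in> \<B> \<Longrightarrow>
     (\<psi> \<circ> f \<circ> inv_into U \<phi>) holomorphic_on \<phi> ` (U \<inter> f -` V)"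
  by (auto simp: Hol_def)

lemma HolI:
  assumes "continuous_on X f" "f ` X \<subseteq> Y"
    "\<And>U \<phi> V \<psi>. (U, \<phi>) \<in> \<A> \<Longrightarrow> (V, \<psi>) \<in> \<B> \<Longrightarrow>
      (\<psi> \<circ> f \<circ> inv_into U \<phi>) holomorphic_on \<phi> ` (U \<inter> f -` V)"
  shows "f \<in> Hol X \<A> Y \<B>"
  using assms by (auto simp: Hol_def)

lemma riemann_surface_chartD:
  assumes "riemann_surface X \<A>" "(U, \<phi>) \<in> \<A>"
  shows "U \<subseteq> X" "openin (top_of_set X) U" "open (\<phi> ` U)" "homeomorphism U (\<phi> ` U) \<phi> (inv_into U \<phi>)"
proof -
  show "openin (top_of_set X) U" "open (\<phi> ` U)" "homeomorphism U (\<phi> ` U) \<phi> (inv_into U \<phi>)"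
    using assms unfolding riemann_surface_def by (auto split: prod.splits)
  then show "U \<subseteq> X"
    by (simp add: openin_imp_subset)
qed

lemma riemann_surface_chart_at:
  assumes "riemann_surface X \<A>" "x \<in> X"
  obtains U \<phi> where "(U, \<phi>) \<in> \<A>" "x \<in> U"
  using assms unfolding riemann_surface_def by fastforce

lemma open_chart_image:
  assumes X: "riemann_surface X \<A>" "(U, \<phi>) \<in> \<A>" and W: "openin (top_of_set X) W" "W \<subseteq> U"
  shows "open (\<phi> ` W)"
proof -
  note U = riemann_surface_chartD[OF X]
  have "openin (top_of_set U) W"
    using W U(1) by (rule openin_subset_trans)
  then have "openin (top_of_set (\<phi> ` U)) (\<phi> ` W)"
    by (rule homeomorphism_imp_open_map[OF U(4)])
  then show ?thesis
    using U(3) openin_open_trans by blast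
qed

lemma Hol_const:
  assumes "c \<in> Y"
  shows "(\<lambda>_. c) \<in> Hol X \<A> Y \<B>"
  using assms by (auto simp: Hol_def o_def intro: continuous_on_const)

text \<open>Holomorphy is local, so near each \<open>x\<close> a single chart of \<open>Y\<close>
  around \<open>f x\<close> splits the composite into two chart expressions. Continuity makes the
  set \<open>N\<close>, on which all three charts apply, open.\<close>

lemma Hol_compose:
  assumes X: "riemann_surface X \<A>" and Y: "riemann_surface Y \<B>" and Z: "riemann_surface Z \<C>"
    and f: "f \<in> Hol X \<A> Y \<B>" and g: "g \<in> Hol Y \<B> Z \<C>"
  shows "g \<circ> f \<in> Hol X \<A> Z \<C>"
proof -
  note cf = Hol_continuous[OF f] and fim = Hol_image[OF f] and cg = Hol_continuous[OF g] and gim = Hol_image[OF g]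
  have cgf: "continuous_on X (g \<circ> f)"
    using cf cg fim by (meson continuous_on_compose continuous_on_subset)
  have hol: "(\<psi> \<circ> (g \<circ> f) \<circ> inv_into U \<phi>) holomorphic_on \<phi> ` (U \<inter> (g \<circ> f) -` V)"
    if U: "(U, \<phi>) \<in> \<A>" and V: "(V, \<psi>) \<in> \<C>" for U \<phi> V \<psi>
  proof -
    note Uc = riemann_surface_chartD[OF X U] and Vc = riemann_surface_chartD[OF Z V]
    let ?h = "\<psi> \<circ> (g \<circ> f) \<circ> inv_into U \<phi>"
    have inj: "inj_on \<phi> U"
      using Uc(4) by (metis homeomorphism_def inj_on_inverseI)
    have inv: "inv_into U \<phi> (\<phi> x) = x" if "x \<in> U" for x
      using that inj by simp
    have "?h field_differentiable (at (\<phi> x))" if x: "x \<in> U" "g (f x) \<in> V" for x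
    proof -
      have xX: "x \<in> X"
        using x Uc(1) by blast
      then obtain W \<eta> where W: "(W, \<eta>) \<in> \<B>" "f x \<in> W"
        using riemann_surface_chart_at[OF Y, of "f x"] fim by blast
      note Wc = riemann_surface_chartD[OF Y W(1)]
      have injW: "inj_on \<eta> W"
        using Wc(4) by (metis homeomorphism_def inj_on_inverseI)
      define N where "N = U \<inter> (X \<inter> f -` W) \<inter> (X \<inter> (g \<circ> f) -` V)"
      have 1: "openin (top_of_set X) (X \<inter> f -` W)"
        using fim by (intro continuous_openin_preimage[OF cf _ Wc(2)]) auto
      have 2: "openin (top_of_set X) (X \<inter> (g \<circ> f) -` V)"
        using fim gim by (intro continuous_openin_preimage[OF cgf _ Vc(2)]) (force simp: image_subset_iff)
      have "openin (top_of_set X) N"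
        unfolding N_def by (rule openin_Int[OF openin_Int[OF Uc(2) 1] 2])
      then have oN: "open (\<phi> ` N)"
        by (rule open_chart_image[OF X U]) (auto simp: N_def)
      have hf: "(\<eta> \<circ> f \<circ> inv_into U \<phi>) holomorphic_on \<phi> ` N"
        using Hol_chart[OF f U W(1)] by (rule holomorphic_on_subset) (auto simp: N_def)
      have hg: "(\<psi> \<circ> g \<circ> inv_into W \<eta>) holomorphic_on \<eta> ` (W \<inter> g -` V)"
        by (rule Hol_chart[OF g W(1) V])
      have "(\<psi> \<circ> g \<circ> inv_into W \<eta>) \<circ> (\<eta> \<circ> f \<circ> inv_into U \<phi>) holomorphic_on \<phi> ` N"
        by (rule holomorphic_on_compose_gen[OF hf hg]) (auto simp: N_def inv)
      then have "?h holomorphic_on \<phi> ` N"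
        by (rule holomorphic_transform) (auto simp: N_def inv injW)
      moreover have "\<phi> x \<in> \<phi> ` N"
        using x xX W by (auto simp: N_def)
      ultimately show ?thesis
        using oN holomorphic_on_imp_differentiable_at by blast
    qed
    then show ?thesis
      unfolding holomorphic_on_def by (auto intro: field_differentiable_at_within)
  qed
  have gfim: "(g \<circ> f) ` X \<subseteq> Z"
    using fim gim unfolding image_comp[symmetric] by blast
  show ?thesis
    using cgf gfim hol by (rule HolI)
qed

section \<open>The disc as a Riemann surface, and holomorphic lifts\<close>

lemma inv_into_ident:
  assumes "w \<in> S"
  shows "inv_into S (\<lambda>z. z) w = w"
  using inv_into_f_f[of "\<lambda>z. z" S w] assms by (simp add: inj_on_def)

lemma riemann_surface_disc: "riemann_surface unit_disc unit_disc_atlas"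
proof -
  have "homeomorphism unit_disc unit_disc (\<lambda>z::complex. z) (inv_into unit_disc (\<lambda>z. z))"
    by (rule homeomorphism_cong[OF homeomorphism_ident]) (auto simp: inv_into_ident)
  moreover have "(inv_into unit_disc (\<lambda>z::complex. z)) holomorphic_on unit_disc"
    by (rule holomorphic_transform[OF holomorphic_on_ident]) (auto simp: inv_into_ident)
  moreover have "Hausdorff_space (top_of_set unit_disc)"
    by (simp add: Hausdorff_space_subtopology)
  ultimately show ?thesis
    by (auto simp: riemann_surface_def o_def)
qed

lemma Hol_disc_chart:
  assumes h: "h \<in> Hol unit_disc unit_disc_atlas X \<A>" and U: "(U, \<phi>) \<in> \<A>"
  shows "(\<phi> \<circ> h) holomorphic_on unit_disc \<inter> h -` U"
proof -
  have "(\<phi> \<circ> h \<circ> inv_into unit_disc (\<lambda>z. z)) holomorphic_on (\<lambda>z. z) ` (unit_disc \<inter> h -` U)"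
    using h U by (intro Hol_chart[of _ unit_disc unit_disc_atlas]) auto
  then have "(\<phi> \<circ> h \<circ> inv_into unit_disc (\<lambda>z. z)) holomorphic_on unit_disc \<inter> h -` U"
    by simp
  then show ?thesis
    by (rule holomorphic_transform) (auto simp: inv_into_ident)
qed

text \<open>Topology provides a continuous lift. It is holomorphic because, near each point, it is
  the composite of \<open>\<phi> \<circ> h\<close> with a local inverse of
  \<open>\<phi> \<circ> p\<close>, and the inverse of an injective holomorphic function is
  holomorphic.\<close>

lemma disc_covering_lift:
  assumes X: "riemann_surface X \<A>" and p: "disc_covering X \<A> p"
    and h: "h \<in> Hol unit_disc unit_disc_atlas X \<A>"
    and z: "z \<in> unit_disc" and a: "a \<in> unit_disc" "h z = p a"
  obtains F where "F holomorphic_on unit_disc" "F ` unit_disc \<subseteq> unit_disc" "F z = a"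
    "\<And>y. y \<in> unit_disc \<Longrightarrow> p (F y) = h y"
proof -
  have cov: "covering_space unit_disc p X" and ph: "p \<in> Hol unit_disc unit_disc_atlas X \<A>"
    using p by (auto simp: disc_covering_def)
  have sc: "simply_connected unit_disc" "locally path_connected unit_disc"
    by (auto intro: convex_imp_simply_connected open_imp_locally_path_connected)
  obtain F where F: "continuous_on unit_disc F" "F ` unit_disc \<subseteq> unit_disc" "F z = a"
    "\<And>y. y \<in> unit_disc \<Longrightarrow> p (F y) = h y"
    using covering_space_lift_topological[OF cov sc Hol_continuous[OF h] Hol_image[OF h] z a] by metis
  have "F field_differentiable (at y)" if y: "y \<in> unit_disc" for y
  proof -
    have Fy: "F y \<in> unit_disc"
      using F(2) y by blast
    then have "p (F y) \<in> X"
      using Hol_image[OF ph] by blast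
    then obtain U \<phi> where U: "(U, \<phi>) \<in> \<A>" "p (F y) \<in> U"
      using riemann_surface_chart_at[OF X] by metis
    note Uc = riemann_surface_chartD[OF X U(1)]
    have injU: "inj_on \<phi> U"
      using Uc(4) by (metis homeomorphism_def inj_on_inverseI)
    obtain T u q where T: "F y \<in> T" "openin (top_of_set unit_disc) T" "homeomorphism T u p q"
      using covering_space_local_homeomorphism[OF cov Fy] by metis
    define S where "S = T \<inter> (unit_disc \<inter> p -` U)"
    have "openin (top_of_set unit_disc) (unit_disc \<inter> p -` U)"
      using Hol_image[OF ph] by (intro continuous_openin_preimage[OF Hol_continuous[OF ph] _ Uc(2)]) auto
    then have "openin (top_of_set unit_disc) S"
      unfolding S_def by (rule openin_Int[OF T(2)])
    then have S: "open S"
      using open_ball openin_open_trans by blast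
    have injS: "inj_on (\<phi> \<circ> p) S"
    proof (rule comp_inj_on)
      show "inj_on p S"
        using T(3) by (intro inj_on_inverseI[of S q p]) (auto simp: S_def homeomorphism_def)
      show "inj_on \<phi> (p ` S)"
        using injU by (rule inj_on_subset) (auto simp: S_def)
    qed
    have "(\<phi> \<circ> p) holomorphic_on S"
      using Hol_disc_chart[OF ph U(1)] by (rule holomorphic_on_subset) (auto simp: S_def)
    then obtain r where r: "r holomorphic_on (\<phi> \<circ> p) ` S" "\<And>w. w \<in> S \<Longrightarrow> r ((\<phi> \<circ> p) w) = w"
      using holomorphic_has_inverse[OF _ S injS] by metis
    define N where "N = unit_disc \<inter> F -` S"
    have N: "open N"
      unfolding N_def using F(1) S by (intro continuous_open_preimage) auto
    have "(\<phi> \<circ> h) holomorphic_on N"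
      using Hol_disc_chart[OF h U(1)] by (rule holomorphic_on_subset) (use F(4) in \<open>auto simp: N_def S_def\<close>)
    then have "r \<circ> (\<phi> \<circ> h) holomorphic_on N"
      by (rule holomorphic_on_compose_gen[OF _ r(1)]) (use F(4) in \<open>force simp: N_def\<close>)
    then have "F holomorphic_on N"
      by (rule holomorphic_transform) (use F(4) r(2) in \<open>force simp: N_def\<close>)
    moreover have "y \<in> N"
      using y U(2) T(1) Fy by (auto simp: N_def S_def)
    ultimately show ?thesis
      using N holomorphic_on_imp_differentiable_at by blast
  qed
  then have "F holomorphic_on unit_disc"
    unfolding holomorphic_on_def by (auto intro: field_differentiable_at_within)
  with F that show ?thesis
    by blast
qed

text \<open>Convergence has to be tested on the generating sets only: the property of containing
  almost all terms passes to finite intersections and to unions, by induction over the generated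
  topology.\<close>

lemma limitin_Hol_topology:
  "limitin (Hol_topology X \<A> Y \<B>) s l F \<longleftrightarrow> l \<in> Hol X \<A> Y \<B> \<and>
    (\<forall>K W. K \<subseteq> X \<and> compact K \<and> openin (top_of_set Y) W \<and> l ` K \<subseteq> W \<longrightarrow>
      (\<forall>\<^sub>F n in F. s n \<in> Hol X \<A> Y \<B> \<and> s n ` K \<subseteq> W))"
  (is "?L \<longleftrightarrow> ?R")
proof -
  let ?H = "Hol X \<A> Y \<B>"
  define S where "S = {{f \<in> ?H. f ` K \<subseteq> W} | K W. K \<subseteq> X \<and> compact K \<and> openin (top_of_set Y) W}"
  have top: "Hol_topology X \<A> Y \<B> = topology_generated_by S"
    by (simp add: Hol_topology_def S_def)
  \<comment> \<open>The empty compact set makes the whole space of maps a generating set, which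
    identifies the \<open>topspace\<close>.\<close>
  have "?H = {f \<in> ?H. f ` {} \<subseteq> Y}"
    by simp
  then have "?H \<in> S"
    unfolding S_def using compact_empty openin_subtopology_self by blast
  then have space: "topspace (Hol_topology X \<A> Y \<B>) = ?H"
    unfolding top topology_generated_by_topspace by (auto simp: S_def)
  show ?thesis
  proof
    assume L: ?L
    show ?R
    proof (intro conjI allI impI)
      show l: "l \<in> ?H"
        using L space by (simp add: limitin_def)
      fix K W assume KW: "K \<subseteq> X \<and> compact K \<and> openin (top_of_set Y) W \<and> l ` K \<subseteq> W"
      have "openin (Hol_topology X \<A> Y \<B>) {f \<in> ?H. f ` K \<subseteq> W}"
        unfolding top by (rule topology_generated_by_Basis) (use KW in \<open>auto simp: S_def\<close>)
      then have "\<forall>\<^sub>F n in F. s n \<in> {f \<in> ?H. f ` K \<subseteq> W}"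
        using L l KW by (auto simp: limitin_def)
      then show "\<forall>\<^sub>F n in F. s n \<in> ?H \<and> s n ` K \<subseteq> W"
        by (rule eventually_mono) blast
    qed
  next
    assume R: ?R
    have "l \<in> U \<longrightarrow> (\<forall>\<^sub>F n in F. s n \<in> U)" if "openin (topology_generated_by S) U" for U
      using that unfolding openin_topology_generated_by_iff
    proof induction
      case (UN \<K>)
      show ?case
      proof
        assume "l \<in> \<Union>\<K>"
        then obtain U where U: "U \<in> \<K>" "l \<in> U"
          by blast
        then have "\<forall>\<^sub>F n in F. s n \<in> U"
          using UN by blast
        then show "\<forall>\<^sub>F n in F. s n \<in> \<Union>\<K>"
          by (rule eventually_mono) (use U in blast)
      qed
    next
      case (Basis U)
      then obtain K W where "U = {f \<in> ?H. f ` K \<subseteq> W}" "K \<subseteq> X" "compact K" "openin (top_of_set Y) W"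
        unfolding S_def by blast
      with R show ?case
        by (auto elim!: eventually_mono)
    qed (auto simp: eventually_conj_iff)
    with R show ?L
      by (auto simp: limitin_def top[symmetric] space)
  qed
qed

lemma limitin_Hol_topology_pointwise:
  assumes lim: "limitin (Hol_topology X \<A> Y \<B>) s g F" and x: "x \<in> X"
  shows "limitin (top_of_set Y) (\<lambda>n. s n x) (g x) F"
proof -
  have "g \<in> Hol X \<A> Y \<B>"
    using lim unfolding limitin_Hol_topology by (rule conjunct1)
  then have "g x \<in> Y"
    using Hol_image x by blast
  moreover have "\<forall>\<^sub>F n in F. s n x \<in> W" if "openin (top_of_set Y) W" "g x \<in> W" for W
  proof -
    have "\<forall>\<^sub>F n in F. s n \<in> Hol X \<A> Y \<B> \<and> s n ` {x} \<subseteq> W"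
      using lim[unfolded limitin_Hol_topology, THEN conjunct2, rule_format, of "{x}" W] that x by simp
    then show ?thesis
      by (rule eventually_mono) simp
  qed
  ultimately show ?thesis
    by (simp add: limitin_def)
qed

section \<open>Left iterations of uniform contractions\<close>

lemma tendsto_0_of_contractive_recursion:
  fixes e \<delta> :: "nat \<Rightarrow> real"
  assumes e: "\<And>n. 0 \<le> e n" and k: "0 \<le> k" "k < 1"
    and rec: "\<And>n. e (Suc n) \<le> k * e n + \<delta> n" and \<delta>: "\<delta> \<longlonglongrightarrow> 0"
  shows "e \<longlonglongrightarrow> 0"
proof (rule LIMSEQ_I)
  fix \<epsilon> :: real assume \<epsilon>: "0 < \<epsilon>"
  \<comment> \<open>With this \<open>\<eta>\<close>, the number \<open>\<epsilon> / 2\<close> is the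
    fixed point of the map sending \<open>t\<close> to \<open>k * t + \<eta>\<close>, so the
    recursion approaches it geometrically.\<close>
  define \<eta> where "\<eta> = \<epsilon> / 2 * (1 - k)"
  have "0 < \<eta>"
    using \<epsilon> k by (simp add: \<eta>_def)
  then have "\<forall>\<^sub>F n in sequentially. \<delta> n < \<eta>"
    using \<delta> by (rule order_tendstoD(2)[rotated])
  then obtain N where N: "\<And>n. n \<ge> N \<Longrightarrow> \<delta> n < \<eta>"
    unfolding eventually_sequentially by blast
  have le: "e (N + j) \<le> k ^ j * e N + \<epsilon> / 2" for j
  proof (induction j)
    case 0
    then show ?case
      using \<epsilon> by simp
  next
    case (Suc j)
    have "e (N + Suc j) \<le> k * e (N + j) + \<eta>"
      using rec[of "N + j"] N[of "N + j"] by simp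
    also have "\<dots> \<le> k * (k ^ j * e N + \<epsilon> / 2) + \<eta>"
      using Suc k by (intro add_right_mono mult_left_mono) auto
    also have "\<dots> = k ^ Suc j * e N + \<epsilon> / 2"
      by (simp add: \<eta>_def field_simps)
    finally show ?case .
  qed
  have "(\<lambda>j. k ^ j * e N) \<longlonglongrightarrow> 0"
    using k by (intro tendsto_mult_left_zero LIMSEQ_realpow_zero) auto
  then have "\<forall>\<^sub>F j in sequentially. k ^ j * e N < \<epsilon> / 2"
    using \<epsilon> by (intro order_tendstoD(2)) auto
  then obtain J where J: "\<And>j. j \<ge> J \<Longrightarrow> k ^ j * e N < \<epsilon> / 2"
    unfolding eventually_sequentially by blast
  have "norm (e n - 0) < \<epsilon>" if "n \<ge> N + J" for n
  proof -
    have "J \<le> n - N" "N + (n - N) = n"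
      using that by auto
    then have "e n < \<epsilon>"
      using le[of "n - N"] J[of "n - N"] by simp
    then show ?thesis
      using e by simp
  qed
  then show "\<exists>no. \<forall>n\<ge>no. norm (e n - 0) < \<epsilon>"
    by blast
qed

locale left_contraction_system = Metric_space +
  fixes f :: "nat \<Rightarrow> 'a \<Rightarrow> 'a" and k :: real and z :: "nat \<Rightarrow> 'a"
  assumes k: "0 < k" "k < 1"
    and f_in: "\<And>n x. x \<in> M \<Longrightarrow> f n x \<in> M"
    and contr: "\<And>n x y. x \<in> M \<Longrightarrow> y \<in> M \<Longrightarrow> d (f n x) (f n y) \<le> k * d x y"
    and z_in: "\<And>n. z n \<in> M" and z_fixed: "\<And>n. f n (z n) = z n"
begin

lemma left_ifs_in: "x \<in> M \<Longrightarrow> left_ifs f n x \<in> M"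
  by (induction n) (auto simp: f_in)

text \<open>The exponent is \<open>Suc n\<close> because \<open>left_ifs f n\<close> composes the
  \<open>n + 1\<close> maps from \<open>f 0\<close> to \<open>f n\<close>.\<close>

lemma left_ifs_contr:
  assumes "x \<in> M" "y \<in> M"
  shows "d (left_ifs f n x) (left_ifs f n y) \<le> k ^ Suc n * d x y"
proof (induction n)
  case 0
  then show ?case
    using contr assms by simp
next
  case (Suc n)
  have "d (left_ifs f (Suc n) x) (left_ifs f (Suc n) y) \<le> k * d (left_ifs f n x) (left_ifs f n y)"
    using contr left_ifs_in assms by simp
  also have "\<dots> \<le> k * (k ^ Suc n * d x y)"
    using Suc k by (intro mult_left_mono) auto
  finally show ?case
    by (simp add: mult.assoc)
qed

lemma power_Suc_mult_tendsto_0: "(\<lambda>n. k ^ Suc n * c) \<longlonglongrightarrow> 0"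
proof -
  have "(\<lambda>n. k ^ n * (k * c)) \<longlonglongrightarrow> 0"
    using k by (intro tendsto_mult_left_zero LIMSEQ_realpow_zero) auto
  then show ?thesis
    by (simp add: mult_ac)
qed

text \<open>\<open>u\<close> and \<open>v\<close> stand for the values of a limit map at
  \<open>x\<close> and \<open>y\<close>. The iterates bring the images of \<open>x\<close> and
  \<open>y\<close> together, so their limits coincide.\<close>

lemma limit_point_constant:
  assumes r: "strict_mono r" and xy: "x \<in> M" "y \<in> M" and uv: "u \<in> M" "v \<in> M"
    and lim: "(\<lambda>n. d (left_ifs f (r n) x) u) \<longlonglongrightarrow> 0" "(\<lambda>n. d (left_ifs f (r n) y) v) \<longlonglongrightarrow> 0"
  shows "u = v"
proof -
  have "d u v \<le> d (left_ifs f (r n) x) u + k ^ Suc (r n) * d x y + d (left_ifs f (r n) y) v" for n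
  proof -
    note L = left_ifs_in[of _ "r n"]
    have "d u v \<le> d u (left_ifs f (r n) x) + d (left_ifs f (r n) x) v"
      using L xy uv by (intro triangle) auto
    also have "d (left_ifs f (r n) x) v \<le> d (left_ifs f (r n) x) (left_ifs f (r n) y) + d (left_ifs f (r n) y) v"
      using L xy uv by (intro triangle) auto
    finally show ?thesis
      using left_ifs_contr[OF xy, of "r n"] by (simp add: commute)
  qed
  moreover have "(\<lambda>n. k ^ Suc (r n) * d x y) \<longlonglongrightarrow> 0"
    using LIMSEQ_subseq_LIMSEQ[OF power_Suc_mult_tendsto_0 r] by (simp add: o_def)
  then have "(\<lambda>n. d (left_ifs f (r n) x) u + k ^ Suc (r n) * d x y + d (left_ifs f (r n) y) v) \<longlonglongrightarrow> 0"
    using lim by (intro tendsto_add_zero)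
  ultimately have "d u v \<le> 0"
    by (intro LIMSEQ_le_const) auto
  then show ?thesis
    using uv nonneg[of u v] zero by force
qed

text \<open>\<open>f (Suc n)\<close> takes one point near \<open>c\<close> to another one and fixes
  \<open>z (Suc n)\<close>. The contraction estimate therefore bounds \<open>d (z (Suc n)) c\<close>
  by \<open>k\<close> times itself plus small terms, and solving for it produces the denominator
  \<open>1 - k\<close>.\<close>

lemma fixed_points_tendsto:
  assumes x: "x \<in> M" and c: "c \<in> M" and lim: "(\<lambda>n. d (left_ifs f n x) c) \<longlonglongrightarrow> 0"
  shows "(\<lambda>n. d (z n) c) \<longlonglongrightarrow> 0"
proof -
  define e where "e n = d (left_ifs f n x) c" for n
  have le: "d (z (Suc n)) c \<le> (k * e n + e (Suc n)) / (1 - k)" for n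
  proof -
    note L = left_ifs_in[OF x, of n] left_ifs_in[OF x, of "Suc n"] and zS = z_in[of "Suc n"] z_fixed[of "Suc n"]
    have "d (z (Suc n)) (left_ifs f (Suc n) x) \<le> k * d (z (Suc n)) (left_ifs f n x)"
      using contr[OF zS(1) L(1), of "Suc n"] by (simp add: zS)
    also have "\<dots> \<le> k * (d (z (Suc n)) c + e n)"
      using triangle[OF zS(1) c L(1)] k by (intro mult_left_mono) (auto simp: e_def commute)
    finally have "d (z (Suc n)) c \<le> k * (d (z (Suc n)) c + e n) + e (Suc n)"
      using triangle[OF zS(1) L(2) c] by (simp add: e_def)
    then show ?thesis
      using k by (simp add: field_simps)
  qed
  have "(\<lambda>n. (k * e n + e (Suc n)) / (1 - k)) \<longlonglongrightarrow> (k * 0 + 0) / (1 - k)"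
    using lim k by (intro tendsto_intros LIMSEQ_Suc) (auto simp: e_def)
  then have "(\<lambda>n. (k * e n + e (Suc n)) / (1 - k)) \<longlonglongrightarrow> 0"
    by simp
  then have "(\<lambda>n. d (z (Suc n)) c) \<longlonglongrightarrow> 0"
    by (rule Lim_null_comparison[rotated]) (simp add: le)
  then show ?thesis
    by (rule LIMSEQ_imp_Suc)
qed

text \<open>Each step contracts towards its own fixed point \<open>z (Suc n)\<close>; replacing this
  moving centre by \<open>c\<close> costs \<open>(k + 1) * d (z (Suc n)) c\<close>, which tends to
  0.\<close>

lemma left_ifs_tendsto:
  assumes x: "x \<in> M" and c: "c \<in> M" and lim: "(\<lambda>n. d (z n) c) \<longlonglongrightarrow> 0"
  shows "(\<lambda>n. d (left_ifs f n x) c) \<longlonglongrightarrow> 0"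
proof (rule tendsto_0_of_contractive_recursion)
  fix n
  note L = left_ifs_in[OF x, of n] left_ifs_in[OF x, of "Suc n"] and zS = z_in[of "Suc n"] z_fixed[of "Suc n"]
  have "d (left_ifs f (Suc n) x) (z (Suc n)) \<le> k * d (left_ifs f n x) (z (Suc n))"
    using contr[OF L(1) zS(1), of "Suc n"] by (simp add: zS)
  also have "\<dots> \<le> k * (d (left_ifs f n x) c + d (z (Suc n)) c)"
    using triangle[OF L(1) c zS(1)] k by (intro mult_left_mono) (auto simp: commute)
  finally show "d (left_ifs f (Suc n) x) c \<le> k * d (left_ifs f n x) c + (k + 1) * d (z (Suc n)) c"
    using triangle[OF L(2) zS(1) c] by (simp add: algebra_simps)
next
  show "(\<lambda>n. (k + 1) * d (z (Suc n)) c) \<longlonglongrightarrow> 0"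
    using LIMSEQ_Suc[OF lim] by (rule tendsto_mult_right_zero)
qed (use k in auto)

text \<open>A compact set is bounded, so its image under \<open>left_ifs f n\<close> clusters around
  the image of \<open>c\<close> at a rate uniform on \<open>K\<close>, and the image of
  \<open>c\<close> tends to \<open>c\<close>.\<close>

lemma left_ifs_uniform_limit:
  assumes K: "compactin mtopology K" and c: "c \<in> M" and lim: "(\<lambda>n. d (z n) c) \<longlonglongrightarrow> 0" and r: "0 < r"
  shows "\<forall>\<^sub>F n in sequentially. left_ifs f n ` K \<subseteq> mball c r"
proof -
  have "mbounded K"
    using K by (rule compactin_imp_mbounded)
  then obtain c' B' where B': "K \<subseteq> mcball c' B'"
    unfolding mbounded_def by blast
  define B where "B = B' + d c' c"
  have B: "x \<in> M \<and> d x c \<le> B" if "x \<in> K" for x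
  proof -
    have "c' \<in> M" "x \<in> M" "d c' x \<le> B'"
      using B' that by (auto simp: mcball_def)
    then show ?thesis
      using triangle[of x c' c] c by (simp add: B_def commute)
  qed
  have "(\<lambda>n. k ^ Suc n * B + d (left_ifs f n c) c) \<longlonglongrightarrow> 0"
    using left_ifs_tendsto[OF c c lim] power_Suc_mult_tendsto_0 by (intro tendsto_add_zero)
  then have "\<forall>\<^sub>F n in sequentially. k ^ Suc n * B + d (left_ifs f n c) c < r"
    using r by (intro order_tendstoD(2)) auto
  then show ?thesis
  proof (rule eventually_mono)
    fix n assume n: "k ^ Suc n * B + d (left_ifs f n c) c < r"
    show "left_ifs f n ` K \<subseteq> mball c r"
    proof (intro image_subsetI)
      fix x assume "x \<in> K"
      then have x: "x \<in> M" "d x c \<le> B"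
        using B by auto
      have "d (left_ifs f n x) c \<le> d (left_ifs f n x) (left_ifs f n c) + d (left_ifs f n c) c"
        using x c left_ifs_in by (intro triangle) auto
      also have "d (left_ifs f n x) (left_ifs f n c) \<le> k ^ Suc n * d x c"
        using x c by (intro left_ifs_contr)
      also have "\<dots> \<le> k ^ Suc n * B"
        using x k by (intro mult_left_mono) auto
      finally show "left_ifs f n x \<in> mball c r"
        using n x c left_ifs_in by (simp add: commute)
    qed
  qed
qed

end

section \<open>The Poincare distance of a hyperbolic surface\<close>

lemma cmod_diff_le_pseudo_dist:
  assumes "a \<in> unit_disc" "b \<in> unit_disc"
  shows "cmod (a - b) \<le> 2 * pseudo_dist a b"
proof -
  have "cmod (1 - cnj a * b) \<le> 1 + cmod a * cmod b"
    using norm_triangle_ineq4[of 1 "cnj a * b"] by (simp add: norm_mult)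
  also have "\<dots> \<le> 2"
    using assms by (simp add: mult_le_one)
  finally have "cmod (1 - cnj a * b) * pseudo_dist a b \<le> 2 * pseudo_dist a b"
    by (intro mult_right_mono) auto
  then show ?thesis
    using one_minus_cnj_mult_nonzero[OF assms] by (simp add: pseudo_dist_def norm_divide)
qed

lemma disc_dist_ball_subset:
  assumes W: "open W" "a \<in> W" and a: "a \<in> unit_disc"
  obtains e where "0 < e" "\<And>b. b \<in> unit_disc \<Longrightarrow> disc_dist a b < e \<Longrightarrow> b \<in> W"
proof -
  obtain \<delta> where \<delta>: "0 < \<delta>" "ball a \<delta> \<subseteq> W"
    using W open_contains_ball by blast
  \<comment> \<open>The cap \<open>1 / 2\<close> keeps \<open>t\<close> in the range where
    \<open>tanh\<close> inverts \<open>artanh\<close>; half of \<open>\<delta>\<close> compensates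
    the factor 2 of \<open>cmod_diff_le_pseudo_dist\<close>.\<close>
  define t where "t = min (\<delta> / 2) (1 / 2)"
  have t: "0 < t" "t < 1" "2 * t \<le> \<delta>"
    using \<delta> by (auto simp: t_def)
  have th: "tanh (artanh t) = t"
    using t by (intro tanh_artanh_real) auto
  show ?thesis
  proof (rule that[of "artanh t"])
    show "0 < artanh t"
      using t th by (metis tanh_real_pos_iff)
    fix b assume b: "b \<in> unit_disc" "disc_dist a b < artanh t"
    then have "pseudo_dist a b < t"
      using th a by (simp add: disc_dist_less_iff)
    then have "cmod (a - b) < \<delta>"
      using cmod_diff_le_pseudo_dist[OF a b(1)] t by linarith
    then show "b \<in> W"
      using \<delta> by (auto simp: dist_norm)
  qed
qed

lemma open_disc_dist_ball:
  assumes a: "a \<in> unit_disc"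
  shows "open {b \<in> unit_disc. disc_dist a b < r}"
proof -
  have "continuous_on unit_disc (pseudo_dist a)"
    unfolding pseudo_dist_def using one_minus_cnj_mult_nonzero[OF a] by (intro continuous_intros) auto
  then have "open (unit_disc \<inter> pseudo_dist a -` {..<tanh r})"
    by (intro continuous_open_preimage) auto
  moreover have "{b \<in> unit_disc. disc_dist a b < r} = unit_disc \<inter> pseudo_dist a -` {..<tanh r}"
    using disc_dist_less_iff[OF a] by auto
  ultimately show ?thesis
    by simp
qed

text \<open>The covering is an arbitrary parameter here; the theorem instantiates it with the one
  selected by \<open>SOME\<close> in \<open>poincare_dist\<close>.\<close>

locale disc_covered_surface =
  fixes X :: "'a::topological_space set" and \<A> :: "'a chart set" and p :: "complex \<Rightarrow> 'a"
  assumes surface: "riemann_surface X \<A>" and covering: "disc_covering X \<A> p"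
begin

lemma cov: "covering_space unit_disc p X" and p_Hol: "p \<in> Hol unit_disc unit_disc_atlas X \<A>"
  using covering by (auto simp: disc_covering_def)

lemma p_in: "a \<in> unit_disc \<Longrightarrow> p a \<in> X"
  using Hol_image[OF p_Hol] by blast

lemma p_surj:
  assumes "x \<in> X"
  obtains a where "a \<in> unit_disc" "x = p a"
  using assms covering_space_imp_surjective[OF cov] by (metis imageE)

definition dist_values :: "'a \<Rightarrow> 'a \<Rightarrow> real set" where
  "dist_values x y = {disc_dist a b | a b. a \<in> unit_disc \<and> b \<in> unit_disc \<and> p a = x \<and> p b = y}"

text \<open>The value 0 off \<open>X\<close> serves the locale \<open>Metric_space\<close>, which
  asks for nonnegativity and symmetry at all arguments, also where the set of values is
  empty.\<close>

definition cover_dist :: "'a \<Rightarrow> 'a \<Rightarrow> real" where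
  "cover_dist x y = (if x \<in> X \<and> y \<in> X then Inf (dist_values x y) else 0)"

lemma dist_valuesI:
  "a \<in> unit_disc \<Longrightarrow> b \<in> unit_disc \<Longrightarrow> p a = x \<Longrightarrow> p b = y \<Longrightarrow> disc_dist a b \<in> dist_values x y"
  unfolding dist_values_def by blast

lemma dist_values_nonneg: "t \<in> dist_values x y \<Longrightarrow> 0 \<le> t"
  unfolding dist_values_def using disc_dist_nonneg by blast

lemma bdd_below_dist_values: "bdd_below (dist_values x y)"
  using dist_values_nonneg by (intro bdd_belowI)

lemma dist_values_nonempty:
  assumes "x \<in> X" "y \<in> X"
  shows "dist_values x y \<noteq> {}"
proof -
  obtain a b where "a \<in> unit_disc" "x = p a" "b \<in> unit_disc" "y = p b"
    using p_surj[OF assms(1)] p_surj[OF assms(2)] by metis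
  then have "disc_dist a b \<in> dist_values x y"
    by (intro dist_valuesI) simp_all
  then show ?thesis
    by blast
qed

text \<open>Lifting \<open>p\<close> through itself so that \<open>a'\<close> goes to
  \<open>a\<close> gives a self-map \<open>T\<close> of the disc over the identity of
  \<open>X\<close>. It moves \<open>b'\<close> within its fibre and, by Schwarz-Pick, increases no
  distance.\<close>

lemma deck_transport:
  assumes "a \<in> unit_disc" "a' \<in> unit_disc" "b' \<in> unit_disc" "p a = p a'"
  obtains b where "b \<in> unit_disc" "p b = p b'" "disc_dist a b \<le> disc_dist a' b'"
proof -
  obtain T where T: "T holomorphic_on unit_disc" "T ` unit_disc \<subseteq> unit_disc" "T a' = a"
    "\<And>y. y \<in> unit_disc \<Longrightarrow> p (T y) = p y"
    using disc_covering_lift[OF surface covering p_Hol assms(2,1) assms(4)[symmetric]] by metis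
  show ?thesis
  proof (rule that[of "T b'"])
    show "T b' \<in> unit_disc"
      using T(2) assms(3) by blast
    show "disc_dist a (T b') \<le> disc_dist a' b'"
      using disc_dist_Schwarz_Pick[OF T(1,2) assms(2,3)] T(3) by simp
  qed (use T(4) assms(3) in auto)
qed

text \<open>By \<open>deck_transport\<close> the infimum over pairs of lifts can be taken with the
  lift of the first point held fixed. The strict inequality spares the question whether the infimum
  is attained.\<close>

lemma cover_dist_less_iff:
  assumes a: "a \<in> unit_disc" and y: "y \<in> X"
  shows "cover_dist (p a) y < r \<longleftrightarrow> (\<exists>b\<in>unit_disc. p b = y \<and> disc_dist a b < r)"
proof -
  have "cover_dist (p a) y < r \<longleftrightarrow> (\<exists>t\<in>dist_values (p a) y. t < r)"
    using cInf_less_iff[OF dist_values_nonempty bdd_below_dist_values] p_in[OF a] y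
    by (simp add: cover_dist_def)
  also have "\<dots> \<longleftrightarrow> (\<exists>b\<in>unit_disc. p b = y \<and> disc_dist a b < r)"
  proof
    assume "\<exists>t\<in>dist_values (p a) y. t < r"
    then obtain a' b' where ab: "a' \<in> unit_disc" "b' \<in> unit_disc" "p a = p a'" "y = p b'" "disc_dist a' b' < r"
      unfolding dist_values_def by auto
    obtain b where "b \<in> unit_disc" "p b = p b'" "disc_dist a b \<le> disc_dist a' b'"
      using deck_transport[OF a ab(1-3)] .
    then show "\<exists>b\<in>unit_disc. p b = y \<and> disc_dist a b < r"
      using ab by force
  qed (use a dist_valuesI in blast)
  finally show ?thesis .
qed

lemma cover_dist_le:
  assumes "a \<in> unit_disc" "b \<in> unit_disc"
  shows "cover_dist (p a) (p b) \<le> disc_dist a b"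
  using assms p_in
  by (auto simp: cover_dist_def intro!: cInf_lower bdd_below_dist_values dist_valuesI)

lemma cover_dist_commute: "cover_dist x y = cover_dist y x"
proof -
  have "dist_values x y = dist_values y x"
    unfolding dist_values_def using disc_dist_commute by blast
  then show ?thesis
    by (simp add: cover_dist_def)
qed

lemma cover_dist_ball_subset:
  assumes W: "openin (top_of_set X) W" and x: "x \<in> W"
  obtains e where "0 < e" "\<And>y. y \<in> X \<Longrightarrow> cover_dist x y < e \<Longrightarrow> y \<in> W"
proof -
  have "x \<in> X"
    using W x openin_imp_subset by blast
  then obtain a where a: "a \<in> unit_disc" "x = p a"
    by (rule p_surj)
  have "openin (top_of_set unit_disc) (unit_disc \<inter> p -` W)"
    using Hol_image[OF p_Hol] by (intro continuous_openin_preimage[OF Hol_continuous[OF p_Hol] _ W]) auto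
  then have "open (unit_disc \<inter> p -` W)"
    using open_ball openin_open_trans by blast
  then obtain e where e: "0 < e" "\<And>b. b \<in> unit_disc \<Longrightarrow> disc_dist a b < e \<Longrightarrow> b \<in> unit_disc \<inter> p -` W"
    using disc_dist_ball_subset[of "unit_disc \<inter> p -` W" a] a x by auto
  show ?thesis
  proof (rule that[OF e(1)])
    fix y assume "y \<in> X" "cover_dist x y < e"
    then obtain b where "b \<in> unit_disc" "p b = y" "disc_dist a b < e"
      using cover_dist_less_iff[OF a(1)] a(2) by auto
    then show "y \<in> W"
      using e(2) by blast
  qed
qed

text \<open>Near-optimal lifts are chosen in succession: \<open>b\<close> for the fixed
  \<open>a\<close>, then \<open>c\<close> for this same \<open>b\<close>, so that the triangle
  inequality of the disc applies.\<close>

lemma cover_dist_triangle: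
  assumes "x \<in> X" "y \<in> X" "w \<in> X"
  shows "cover_dist x w \<le> cover_dist x y + cover_dist y w"
proof (rule field_le_epsilon)
  fix \<epsilon> :: real assume \<epsilon>: "0 < \<epsilon>"
  obtain a where a: "a \<in> unit_disc" "x = p a"
    using p_surj[OF assms(1)] .
  have "cover_dist x y < cover_dist x y + \<epsilon> / 2"
    using \<epsilon> by simp
  then obtain b where b: "b \<in> unit_disc" "p b = y" "disc_dist a b < cover_dist x y + \<epsilon> / 2"
    unfolding a(2) using cover_dist_less_iff[OF a(1) assms(2)] by blast
  have "cover_dist y w < cover_dist y w + \<epsilon> / 2"
    using \<epsilon> by simp
  then obtain c where c: "c \<in> unit_disc" "p c = w" "disc_dist b c < cover_dist y w + \<epsilon> / 2"
    using cover_dist_less_iff[OF b(1) assms(3)] unfolding b(2) by blast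
  have "cover_dist x w \<le> disc_dist a c"
    using cover_dist_le[OF a(1) c(1)] a(2) c(2) by simp
  also have "\<dots> \<le> disc_dist a b + disc_dist b c"
    using a b c by (intro disc_dist_triangle)
  finally show "cover_dist x w \<le> cover_dist x y + cover_dist y w + \<epsilon>"
    using b c by simp
qed

sublocale cover: Metric_space X cover_dist
proof
  show nonneg: "0 \<le> cover_dist x y" for x y
    using dist_values_nonempty dist_values_nonneg by (auto simp: cover_dist_def intro!: cInf_greatest)
  show "cover_dist x y = cover_dist y x" for x y
    by (rule cover_dist_commute)
  show "cover_dist x y = 0 \<longleftrightarrow> x = y" if xy: "x \<in> X" "y \<in> X" for x y
  proof
    assume 0: "cover_dist x y = 0"
    show "x = y"
    proof (rule ccontr)
      assume "x \<noteq> y"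
      \<comment> \<open>Points are closed in a Hausdorff space, so some metric ball around
        \<open>x\<close> avoids \<open>y\<close>, against distance 0.\<close>
      have "t1_space (top_of_set X)"
        using surface by (simp add: riemann_surface_def Hausdorff_imp_t1_space)
      then have "closedin (top_of_set X) {y}"
        using xy by (simp add: t1_space_closedin_singleton)
      then have "openin (top_of_set X) (X - {y})"
        using openin_diff[OF openin_subtopology_self] by blast
      then obtain e where "0 < e" and e: "\<And>u. u \<in> X \<Longrightarrow> cover_dist x u < e \<Longrightarrow> u \<in> X - {y}"
        using cover_dist_ball_subset[of "X - {y}" x] xy \<open>x \<noteq> y\<close> by auto
      then show False
        using 0 xy e[of y] by simp
    qed
  next
    assume "x = y"
    obtain a where "a \<in> unit_disc" "x = p a"
      using p_surj[OF xy(1)] .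
    then have "cover_dist x y \<le> 0"
      using cover_dist_le[of a a] \<open>x = y\<close> by simp
    then show "cover_dist x y = 0"
      using nonneg[of x y] by simp
  qed
qed (rule cover_dist_triangle)

text \<open>A metric ball around \<open>p a\<close> is the image under \<open>p\<close> of a ball
  around \<open>a\<close>, hence open; the converse is \<open>cover_dist_ball_subset\<close>.
  Compactness and limits in \<open>X\<close> thereby become metric notions.\<close>

lemma cover_mtopology: "cover.mtopology = top_of_set X"
proof (rule topology_eq[THEN iffD2], intro allI iffI)
  fix U assume "openin cover.mtopology U"
  then have U: "U \<subseteq> X" "\<And>x. x \<in> U \<Longrightarrow> \<exists>r>0. cover.mball x r \<subseteq> U"
    by (auto simp: cover.openin_mtopology)
  show "openin (top_of_set X) U"
  proof (subst openin_subopen, intro ballI)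
    fix x assume x: "x \<in> U"
    obtain r where r: "0 < r" "cover.mball x r \<subseteq> U"
      using U(2)[OF x] by blast
    obtain a where a: "a \<in> unit_disc" "x = p a"
      using p_surj U(1) x by blast
    have "cover.mball x r = p ` {b \<in> unit_disc. disc_dist a b < r}"
    proof (rule set_eqI)
      fix y
      have "y \<in> cover.mball x r \<longleftrightarrow> y \<in> X \<and> cover_dist (p a) y < r"
        using p_in[OF a(1)] a(2) by simp
      also have "\<dots> \<longleftrightarrow> y \<in> X \<and> (\<exists>b\<in>unit_disc. p b = y \<and> disc_dist a b < r)"
        using cover_dist_less_iff[OF a(1)] by blast
      also have "\<dots> \<longleftrightarrow> y \<in> p ` {b \<in> unit_disc. disc_dist a b < r}"
        using p_in by blast
      finally show "y \<in> cover.mball x r \<longleftrightarrow> y \<in> p ` {b \<in> unit_disc. disc_dist a b < r}" .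
    qed
    moreover have "openin (top_of_set unit_disc) {b \<in> unit_disc. disc_dist a b < r}"
      using open_disc_dist_ball[OF a(1)] by (intro open_subset) auto
    ultimately have "openin (top_of_set X) (cover.mball x r)"
      using openin_covering_image[OF cov] by simp
    then show "\<exists>T. openin (top_of_set X) T \<and> x \<in> T \<and> T \<subseteq> U"
      using r U(1) x by auto
  qed
next
  fix U assume U: "openin (top_of_set X) U"
  have "\<exists>r>0. cover.mball x r \<subseteq> U" if x: "x \<in> U" for x
  proof -
    obtain e where "0 < e" "\<And>y. y \<in> X \<Longrightarrow> cover_dist x y < e \<Longrightarrow> y \<in> U"
      using cover_dist_ball_subset[OF U x] by metis
    then show ?thesis
      by (intro exI[of _ e]) (simp add: subset_iff)
  qed
  then show "openin cover.mtopology U"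
    using openin_imp_subset[OF U] unfolding cover.openin_mtopology by blast
qed

section \<open>Self-maps with image in a Bloch domain\<close>

lemma Hol_lift:
  assumes f: "f \<in> Hol X \<A> X \<A>"
  obtains F where "F holomorphic_on unit_disc" "F ` unit_disc \<subseteq> unit_disc"
    "\<And>a. a \<in> unit_disc \<Longrightarrow> p (F a) = f (p a)"
proof -
  have 0: "(0::complex) \<in> unit_disc"
    by simp
  have "f (p 0) \<in> X"
    using Hol_image[OF f] p_in[OF 0] by blast
  then obtain a where a: "a \<in> unit_disc" "f (p 0) = p a"
    by (rule p_surj)
  have "f \<circ> p \<in> Hol unit_disc unit_disc_atlas X \<A>"
    by (rule Hol_compose[OF riemann_surface_disc surface surface p_Hol f])
  then obtain F where "F holomorphic_on unit_disc" "F ` unit_disc \<subseteq> unit_disc"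
      "\<And>y. y \<in> unit_disc \<Longrightarrow> p (F y) = (f \<circ> p) y"
    using disc_covering_lift[OF surface covering _ 0 a(1), of "f \<circ> p"] a(2) by (metis comp_apply)
  then show ?thesis
    using that by simp
qed

text \<open>The hypothesis \<open>gap\<close> is the Bloch condition in the form used: a ball of
  radius \<open>R\<close> around a point of \<open>\<Omega>\<close> always leaves
  \<open>\<Omega>\<close>. A lift of the point reached outside is a value that every lift
  \<open>F\<close> of \<open>f\<close> omits, since \<open>p\<close> sends the image of
  \<open>F\<close> into \<open>\<Omega>\<close>.\<close>

lemma bloch_contraction:
  assumes R: "0 < R" and gap: "\<And>x. x \<in> \<Omega> \<Longrightarrow> \<exists>y\<in>X - \<Omega>. cover_dist x y < R"
  obtains k where "0 < k" "k < 1"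
    "\<And>f x y. \<lbrakk>f \<in> Hol X \<A> X \<A>; f ` X \<subseteq> \<Omega>; x \<in> X; y \<in> X\<rbrakk>
       \<Longrightarrow> cover_dist (f x) (f y) \<le> k * cover_dist x y"
    "\<And>f. f \<in> Hol X \<A> X \<A> \<Longrightarrow> f ` X \<subseteq> \<Omega> \<Longrightarrow> \<exists>x\<in>X. f x = x"
proof -
  obtain k where k: "0 < k" "k < 1"
    and contr: "\<And>F a b. \<lbrakk>F holomorphic_on unit_disc; F ` unit_disc \<subseteq> unit_disc;
       \<And>a. a \<in> unit_disc \<Longrightarrow> \<exists>v\<in>unit_disc - F ` unit_disc. disc_dist (F a) v \<le> R;
       a \<in> unit_disc; b \<in> unit_disc\<rbrakk> \<Longrightarrow> disc_dist (F a) (F b) \<le> k * disc_dist a b"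
    using disc_contraction_of_omitted_values[OF R] by metis
  have lift: "\<exists>F. F holomorphic_on unit_disc \<and> F ` unit_disc \<subseteq> unit_disc \<and>
      (\<forall>a\<in>unit_disc. p (F a) = f (p a)) \<and>
      (\<forall>a\<in>unit_disc. \<forall>b\<in>unit_disc. disc_dist (F a) (F b) \<le> k * disc_dist a b)"
    if f: "f \<in> Hol X \<A> X \<A>" and im: "f ` X \<subseteq> \<Omega>" for f
  proof -
    obtain F where F: "F holomorphic_on unit_disc" "F ` unit_disc \<subseteq> unit_disc"
      "\<And>a. a \<in> unit_disc \<Longrightarrow> p (F a) = f (p a)"
      using Hol_lift[OF f] by metis
    have pF: "p (F a) \<in> \<Omega>" if "a \<in> unit_disc" for a
      using F(3)[OF that] im p_in[OF that] by auto
    have "\<exists>v\<in>unit_disc - F ` unit_disc. disc_dist (F a) v \<le> R" if a: "a \<in> unit_disc" for a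
    proof -
      have Fa: "F a \<in> unit_disc"
        using F(2) a by blast
      obtain y where y: "y \<in> X" "y \<notin> \<Omega>" "cover_dist (p (F a)) y < R"
        using gap[OF pF[OF a]] by blast
      then obtain v where "v \<in> unit_disc" "p v = y" "disc_dist (F a) v < R"
        using cover_dist_less_iff[OF Fa y(1)] by blast
      moreover have "v \<notin> F ` unit_disc"
        using pF \<open>p v = y\<close> y(2) by blast
      ultimately show ?thesis
        by (intro bexI[of _ v]) auto
    qed
    then show ?thesis
      using F contr[OF F(1,2)] by blast
  qed
  show ?thesis
  proof (rule that[OF k])
    fix f x y
    assume f: "f \<in> Hol X \<A> X \<A>" "f ` X \<subseteq> \<Omega>" and xy: "x \<in> X" "y \<in> X"
    obtain F where F: "F ` unit_disc \<subseteq> unit_disc" "\<And>a. a \<in> unit_disc \<Longrightarrow> p (F a) = f (p a)"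
      "\<And>a b. a \<in> unit_disc \<Longrightarrow> b \<in> unit_disc \<Longrightarrow> disc_dist (F a) (F b) \<le> k * disc_dist a b"
      using lift[OF f] by blast
    obtain a where a: "a \<in> unit_disc" "x = p a"
      using p_surj[OF xy(1)] .
    show "cover_dist (f x) (f y) \<le> k * cover_dist x y"
    \<comment> \<open>A failure of the inequality is a strict bound on an infimum, hence yields an
      actual lift \<open>b\<close> of \<open>y\<close>, to which the contraction of \<open>F\<close>
      applies.\<close>
    proof (rule ccontr)
      assume "\<not> ?thesis"
      then have "cover_dist (p a) y < cover_dist (f x) (f y) / k"
        using k a(2) by (simp add: field_simps)
      then obtain b where b: "b \<in> unit_disc" "p b = y" "disc_dist a b < cover_dist (f x) (f y) / k"
        using cover_dist_less_iff[OF a(1) xy(2)] by blast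
      have "F a \<in> unit_disc" "F b \<in> unit_disc"
        using F(1) a b by blast+
      then have "cover_dist (f x) (f y) \<le> disc_dist (F a) (F b)"
        using cover_dist_le[of "F a" "F b"] F(2) a b by simp
      also have "\<dots> \<le> k * disc_dist a b"
        by (rule F(3)[OF a(1) b(1)])
      finally show False
        using b(3) k by (simp add: field_simps)
    qed
  next
    fix f
    assume f: "f \<in> Hol X \<A> X \<A>" "f ` X \<subseteq> \<Omega>"
    obtain F where F: "F holomorphic_on unit_disc" "F ` unit_disc \<subseteq> unit_disc"
      "\<And>a. a \<in> unit_disc \<Longrightarrow> p (F a) = f (p a)"
      "\<And>a b. a \<in> unit_disc \<Longrightarrow> b \<in> unit_disc \<Longrightarrow> disc_dist (F a) (F b) \<le> k * disc_dist a b"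
      using lift[OF f] by blast
    have F0: "F 0 \<in> unit_disc"
      using F(2) by (meson centre_in_ball image_subset_iff zero_less_one)
    \<comment> \<open>\<open>m\<close> solves \<open>disc_dist 0 (F 0) + k * m = m\<close>, so the
      closed hyperbolic ball of radius \<open>m\<close> about \<open>0\<close> is mapped into
      itself. This ball is \<open>cball 0 (tanh m)\<close>, compact and convex as Brouwer's theorem
      requires.\<close>
    define m where "m = disc_dist 0 (F 0) / (1 - k)"
    have m: "0 \<le> m"
      using disc_dist_nonneg[OF _ F0, of 0] k by (simp add: m_def)
    have sub: "cball 0 (tanh m) \<subseteq> unit_disc"
      using tanh_real_lt_1[of m] by auto
    have ball_iff: "z \<in> cball 0 (tanh m) \<longleftrightarrow> disc_dist 0 z \<le> m" if "z \<in> unit_disc" for z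
      using disc_dist_le_iff[OF _ that, of 0 m] by simp
    have "F z \<in> cball 0 (tanh m)" if "z \<in> cball 0 (tanh m)" for z
    proof -
      have z: "z \<in> unit_disc"
        using that sub by blast
      then have Fz: "F z \<in> unit_disc"
        using F(2) by blast
      have "disc_dist 0 (F z) \<le> disc_dist 0 (F 0) + disc_dist (F 0) (F z)"
        using F0 Fz by (intro disc_dist_triangle) auto
      also have "\<dots> \<le> disc_dist 0 (F 0) + k * disc_dist 0 z"
        using z by (intro add_left_mono F(4)) auto
      also have "\<dots> \<le> (1 - k) * m + k * m"
        using that ball_iff[OF z] k by (intro add_mono mult_left_mono) (auto simp: m_def)
      finally show ?thesis
        using ball_iff[OF Fz] by (simp add: algebra_simps)
    qed
    then have im: "F \<in> cball 0 (tanh m) \<rightarrow> cball 0 (tanh m)"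
      by blast
    have "continuous_on (cball 0 (tanh m)) F"
      using holomorphic_on_imp_continuous_on[OF F(1)] sub continuous_on_subset by blast
    then obtain w where "w \<in> cball 0 (tanh m)" "F w = w"
      using brouwer[OF compact_cball convex_cball _ _ im] m by auto
    then have "w \<in> unit_disc" "f (p w) = p w"
      using sub F(3)[of w] by auto
    then show "\<exists>x\<in>X. f x = x"
      using p_in by blast
  qed
qed

end

section \<open>Transfer to the surface: limit maps and fixed points\<close>

lemma tendsto_iff_limitin_subspace:
  assumes "\<And>n. s n \<in> X" "l \<in> X"
  shows "s \<longlonglongrightarrow> l \<longleftrightarrow> limitin (top_of_set X) s l sequentially"
  using assms by (simp add: limitin_subtopology)

theorem theorem1p5:
  fixes X \<Omega> :: "'a::topological_space set"
    and \<A> :: "'a chart set"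
    and f :: "nat \<Rightarrow> 'a \<Rightarrow> 'a"
  assumes "hyperbolic_surface X \<A>"
    and "bloch_domain \<Omega> X \<A>"
    and "\<And>\<nu>. f \<nu> \<in> Hol X \<A> X \<A>"
    and "\<And>\<nu>. f \<nu> ` X \<subseteq> \<Omega>"
    and "\<And>\<nu>. \<exists>x\<in>X. f \<nu> x \<noteq> x"
  shows "(\<forall>g r. strict_mono r \<and> limitin (Hol_topology X \<A> X \<A>) (left_ifs f \<circ> r) g sequentially
            \<longrightarrow> (\<exists>c\<in>X. \<forall>x\<in>X. g x = c))
       \<and> (\<exists>z. (\<forall>\<nu>. z \<nu> \<in> \<Omega> \<and> (\<forall>x\<in>X. f \<nu> x = x \<longleftrightarrow> x = z \<nu>))
            \<and> (\<forall>z_inf\<in>X. limitin (Hol_topology X \<A> X \<A>) (left_ifs f) (\<lambda>_. z_inf) sequentially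
                 \<longleftrightarrow> z \<longlonglongrightarrow> z_inf))"
proof -
  \<comment> \<open>The same choice as in \<open>poincare_dist\<close>, so that
    \<open>cover_dist\<close> agrees with it on \<open>X\<close>.\<close>
  define p where "p = (SOME p. disc_covering X \<A> p)"
  have X: "riemann_surface X \<A>" and ex: "\<exists>p. disc_covering X \<A> p"
    using assms(1) by (auto simp: hyperbolic_surface_def)
  have "disc_covering X \<A> p"
    unfolding p_def using ex by (rule someI_ex)
  with X interpret disc_covered_surface X \<A> p
    by unfold_locales
  have pd: "poincare_dist X \<A> x y = cover_dist x y" if "x \<in> X" "y \<in> X" for x y
    using that by (simp add: poincare_dist_def cover_dist_def dist_values_def Let_def flip: p_def)
  have \<Omega>X: "\<Omega> \<subseteq> X" and bloch: "bloch_radius \<Omega> X \<A> < \<infinity>"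
    using assms(2) openin_imp_subset by (auto simp: bloch_domain_def)
  obtain R0 :: real where R0: "bloch_radius \<Omega> X \<A> \<le> ereal R0"
    using bloch less_PInf_Ex_of_nat[of "bloch_radius \<Omega> X \<A>"] by (auto intro: less_imp_le)
  \<comment> \<open>\<open>R\<close> is positive and strictly above the Bloch radius, so no ball of
    radius \<open>R\<close> around a point of \<open>\<Omega>\<close> fits into
    \<open>\<Omega>\<close>.\<close>
  define R where "R = max R0 0 + 1"
  have R: "0 < R" "R0 < R"
    by (auto simp: R_def)
  have gap: "\<exists>y\<in>X - \<Omega>. cover_dist x y < R" if "x \<in> \<Omega>" for x
  proof (rule ccontr)
    assume "\<not> ?thesis"
    moreover have "x \<in> X"
      using that \<Omega>X by blast
    ultimately have "poincare_ball X \<A> x R \<subseteq> \<Omega>"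
      by (auto simp: poincare_ball_def pd)
    then have "ereal R \<le> bloch_radius \<Omega> X \<A>"
      unfolding bloch_radius_def using R(1) that by (intro Sup_upper) blast
    then have "ereal R \<le> ereal R0"
      using R0 by (rule order_trans)
    with R show False
      by simp
  qed
  obtain k where k: "0 < k" "k < 1"
    and contraction: "\<And>g x y. \<lbrakk>g \<in> Hol X \<A> X \<A>; g ` X \<subseteq> \<Omega>; x \<in> X; y \<in> X\<rbrakk>
       \<Longrightarrow> cover_dist (g x) (g y) \<le> k * cover_dist x y"
    and fixed_point: "\<And>g. g \<in> Hol X \<A> X \<A> \<Longrightarrow> g ` X \<subseteq> \<Omega> \<Longrightarrow> \<exists>x\<in>X. g x = x"
    using bloch_contraction[where \<Omega> = \<Omega>, OF R(1) gap] by blast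
  note contr = contraction[OF assms(3,4)] and fixed = fixed_point[OF assms(3,4)]
  from fixed obtain z where z: "\<And>\<nu>. z \<nu> \<in> X" "\<And>\<nu>. f \<nu> (z \<nu>) = z \<nu>"
    by metis
  have f_in: "f \<nu> x \<in> X" if "x \<in> X" for \<nu> x
    using that assms(4) \<Omega>X by blast
  interpret left_contraction_system X cover_dist f k z
    by unfold_locales (use k contr z f_in in auto)
  have L_Hol: "left_ifs f n \<in> Hol X \<A> X \<A>" for n
  proof (induction n)
    case (Suc n)
    show ?case
      unfolding left_ifs.simps by (rule Hol_compose[OF X X X Suc assms(3)])
  qed (simp add: assms(3))
  have lim_iff: "limitin (top_of_set X) s l sequentially \<longleftrightarrow> (\<lambda>n. cover_dist (s n) l) \<longlonglongrightarrow> 0"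
    if "\<And>n. s n \<in> X" "l \<in> X" for s l
    using that unfolding cover_mtopology[symmetric] cover.limitin_metric_dist_null by simp
  have pointwise: "g x \<in> X" "(\<lambda>n. cover_dist (s n x) (g x)) \<longlonglongrightarrow> 0"
    if "limitin (Hol_topology X \<A> X \<A>) s g sequentially" "\<And>n. s n x \<in> X" "x \<in> X" for s g x
  proof -
    have lim: "limitin (top_of_set X) (\<lambda>n. s n x) (g x) sequentially"
      using that(1,3) by (rule limitin_Hol_topology_pointwise)
    then show g: "g x \<in> X"
      by (simp add: limitin_def)
    show "(\<lambda>n. cover_dist (s n x) (g x)) \<longlonglongrightarrow> 0"
      using lim lim_iff[of "\<lambda>n. s n x" "g x"] that(2) g by simp
  qed
  obtain x0 where x0: "x0 \<in> X"
    using z(1) by blast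
  show ?thesis
  proof (intro conjI allI impI exI[of _ z] ballI)
    fix g r assume gr: "strict_mono r \<and> limitin (Hol_topology X \<A> X \<A>) (left_ifs f \<circ> r) g sequentially"
    have in_X: "(left_ifs f \<circ> r) n x \<in> X" if "x \<in> X" for n x
      using left_ifs_in[OF that] by simp
    note g = pointwise(1)[OF conjunct2[OF gr] in_X]
    have lim: "(\<lambda>n. cover_dist (left_ifs f (r n) x) (g x)) \<longlonglongrightarrow> 0" if "x \<in> X" for x
      using pointwise(2)[OF conjunct2[OF gr] in_X[OF that] that] by simp
    have "g x = g x0" if "x \<in> X" for x
      by (rule limit_point_constant[OF conjunct1[OF gr] that x0 g[OF that that] g[OF x0 x0] lim[OF that] lim[OF x0]])
    then show "\<exists>c\<in>X. \<forall>x\<in>X. g x = c"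
      using g[OF x0 x0] by blast
  next
    fix \<nu>
    have "f \<nu> (z \<nu>) \<in> \<Omega>"
      using assms(4) z(1) by blast
    then show "z \<nu> \<in> \<Omega>"
      by (simp add: z)
    fix x assume x: "x \<in> X"
    show "f \<nu> x = x \<longleftrightarrow> x = z \<nu>"
    proof
      assume fx: "f \<nu> x = x"
      have "cover_dist x (z \<nu>) \<le> k * cover_dist x (z \<nu>)"
        using contr[OF x z(1), of \<nu> \<nu>] by (simp add: fx z)
      then have "(1 - k) * cover_dist x (z \<nu>) \<le> 0"
        by (simp add: left_diff_distrib)
      then have "cover_dist x (z \<nu>) = 0"
        using k cover.nonneg[of x "z \<nu>"] by (simp add: mult_le_0_iff)
      then show "x = z \<nu>"
        using x z(1) cover.zero by blast
    qed (simp add: z)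
  next
    fix c assume c: "c \<in> X"
    \<comment> \<open>The left side is convergence in the ambient type; since all points lie in
      \<open>X\<close>, it agrees with convergence in the subspace, which is metric.\<close>
    have z_iff: "z \<longlonglongrightarrow> c \<longleftrightarrow> (\<lambda>n. cover_dist (z n) c) \<longlonglongrightarrow> 0"
      using tendsto_iff_limitin_subspace[of z X c] lim_iff[of z c] z(1) c by simp
    show "limitin (Hol_topology X \<A> X \<A>) (left_ifs f) (\<lambda>_. c) sequentially \<longleftrightarrow> z \<longlonglongrightarrow> c"
    proof
      assume "limitin (Hol_topology X \<A> X \<A>) (left_ifs f) (\<lambda>_. c) sequentially"
      then have "(\<lambda>n. cover_dist (left_ifs f n x0) c) \<longlonglongrightarrow> 0"
        using pointwise(2)[of "left_ifs f" "\<lambda>_. c" x0] left_ifs_in[OF x0] x0 by simp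
      then show "z \<longlonglongrightarrow> c"
        using fixed_points_tendsto[OF x0 c] z_iff by blast
    next
      assume "z \<longlonglongrightarrow> c"
      then have lim: "(\<lambda>n. cover_dist (z n) c) \<longlonglongrightarrow> 0"
        by (simp add: z_iff)
      show "limitin (Hol_topology X \<A> X \<A>) (left_ifs f) (\<lambda>_. c) sequentially"
        unfolding limitin_Hol_topology
      proof (intro conjI allI impI)
        show "(\<lambda>_. c) \<in> Hol X \<A> X \<A>"
          using c by (rule Hol_const)
        fix K W assume KW: "K \<subseteq> X \<and> compact K \<and> openin (top_of_set X) W \<and> (\<lambda>_. c) ` K \<subseteq> W"
        show "\<forall>\<^sub>F n in sequentially. left_ifs f n \<in> Hol X \<A> X \<A> \<and> left_ifs f n ` K \<subseteq> W"
        \<comment> \<open>Only a nonempty \<open>K\<close> forces \<open>c \<in> W\<close>; for the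
          empty one the image condition is trivial.\<close>
        proof (cases "K = {}")
          case False
          then have "c \<in> W" "openin cover.mtopology W"
            using KW by (auto simp: cover_mtopology)
          then obtain \<epsilon> where \<epsilon>: "0 < \<epsilon>" "cover.mball c \<epsilon> \<subseteq> W"
            unfolding cover.openin_mtopology by blast
          have "compactin cover.mtopology K"
            using KW by (simp add: cover_mtopology compactin_subtopology)
          then have "\<forall>\<^sub>F n in sequentially. left_ifs f n ` K \<subseteq> cover.mball c \<epsilon>"
            by (rule left_ifs_uniform_limit[OF _ c lim \<epsilon>(1)])
          then show ?thesis
            by (rule eventually_mono) (use \<epsilon>(2) L_Hol in blast)
        qed (simp add: L_Hol)
      qed
    qed
  qed
qed

end
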